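(* Let $\mathbb A$ be a double category, and let $I\in \mathbb A$ be an object. The following statements are equivalent. (i) The object $I$ is double bi-initial in $\mathbb A$. (ii) The object $I$ is bi-initial in the $2$-category $\mathbf H\mathbb A$ and the vertical identity $\mathrm e_I$ is bi-initial in the $2$-category $\mathcal V\mathbb A$. (iii) The vertical identity $\mathrm e_I$ is bi-initial in $\mathcal V\mathbb A$.
   Context: **Double categories** are strict. They have objects, horizontal morphisms, vertical morphisms and squares; a square has a top and a bottom horizontal morphism and a left and a right vertical morphism. $\mathrm e_A$ denotes the vertical identity at $A$. A square whose left and right boundaries are vertical identities is vertically invertible if it has an inverse for vertical composition. **$\mathbf H\mathbb A$** is the $2$-category with the objects of $\mathbb A$, morphisms the horizontal morphisms of $\mathbb A$, and $2$-morphisms $a\Rightarrow b$ (for $a,b\colon A\to A'$) the squares with top $a$, bottom $b$, left $\mathrm e_A$, right $\mathrm e_{A'}$. **$\mathcal V\mathbb A$** is the $2$-category whose objects are the vertical morphisms of $\mathbb A$; morphisms $u\to u'$ are squares with left boundary $u$ and right boundary $u'$, composed horizontally; and $2$-morphisms from $\alpha$ (top $a\colon A\to A'$, bottom $b\colon B\to B'$) to $\alpha'$ (top $a'$, bottom $b'$), both from $u$ to $u'$, are pairs $(\sigma_0,\sigma_1)$ of squares, $\sigma_0$ with top $a$, bottom $a'$ and vertical identities on the sides, $\sigma_1$ with top $b$, bottom $b'$ and vertical identities on the sides, such that $\sigma_0$ pasted vertically above $\alpha'$ equals $\alpha$ pasted vertically above $\sigma_1$. **Bi-initial object.** For an object $I$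 of a $2$-category $\mathbf A$, the pseudo-slice $2$-category $I\downarrow\mathbf A$ has objects $(A,f\colon I\to A)$; morphisms $(A,f)\to(A',f')$ pairs $(a,\psi)$ of $a\colon A\to A'$ and an invertible $\psi\colon f'\Rightarrow af$; $2$-morphisms $(a,\psi)\Rightarrow(b,\varphi)$ the $2$-morphisms $\beta\colon a\Rightarrow b$ with $(\beta f)\circ\psi=\varphi$. A $2$-functor is a trivial fibration if it is surjective on objects, full on morphisms (every morphism $FA\to FA'$ is the image of some morphism $A\to A'$) and fully faithful on $2$-morphisms. $I$ is bi-initial if the projection $I\downarrow\mathbf A\to\mathbf A$ is a trivial fibration. **Double bi-initial object.** For an object $I$ of $\mathbb A$, the pseudo-slice double category $I\downarrow\downarrow\mathbb A$ has: objects $(A,f)$ with $f\colon I\to A$ horizontal; horizontal morphisms $(A,f)\to(A',f')$: pairs $(a,\psi)$ of a horizontal $a\colon A\to A'$ and a vertically invertible square $\psi$ with top $f'$, bottom $af$, left $\mathrm e_I$, right $\mathrm e_{A'}$; vertical morphisms from $(A,f)$ to $(B,g)$: pairs $(u,\gamma)$ of a vertical morphism $u$ from $A$ to $B$ and a square $\gamma$ with top $f$, bottom $g$, left $\mathrm e_I$, right $u$; squares with top $(a,\psi)$, bottom $(b,\varphi)$, left $(u,\gamma)$, right $(u',\gamma')$: squares $\alpha$ of $\mathbb A$ with top $a$, bottom $b$, left $u$, right $u'$ such that $\psi$ pasted vertically above the horizontal composite of $\gamma$ and $\alpha$ equals $\gamma'$ pasted vertically above $\varphi$. Let $\Pi\colon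 I\downarrow\downarrow\mathbb A\to\mathbb A$ be the projection. A double functor is a double trivial fibration if it is surjective on objects, full on horizontal morphisms (every horizontal morphism $FA\to FA'$ is the image of some $A\to A'$), surjective on vertical morphisms, and fully faithful on squares (every square whose boundary is the image of a given boundary is the image of a unique square with that given boundary). The object $I$ is double bi-initial if $\Pi$ is a double trivial fibration. *)

theory Defs
  imports Main
begin

section \<open>Strict categories, 2-categories and 2-functors\<close>

text \<open>
  All structures are carrier-based: the axioms speak only about elements of the carriers, and the
  value of a composition operation on a non-composable pair is unspecified and never used.
  In \<open>comp g f\<close> the morphism \<open>f\<close> comes first.
\<close>

locale category =
  fixes Ob :: "'o set" and Mor :: "'m set"
    and src tgt :: "'m \<Rightarrow> 'o" and ident :: "'o \<Rightarrow> 'm" and comp :: "'m \<Rightarrow> 'm \<Rightarrow> 'm"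
  assumes src_closed: "f \<in> Mor \<Longrightarrow> src f \<in> Ob"
    and tgt_closed: "f \<in> Mor \<Longrightarrow> tgt f \<in> Ob"
    and ident_closed: "x \<in> Ob \<Longrightarrow> ident x \<in> Mor"
    and src_ident: "x \<in> Ob \<Longrightarrow> src (ident x) = x"
    and tgt_ident: "x \<in> Ob \<Longrightarrow> tgt (ident x) = x"
    and comp_closed: "\<lbrakk>f \<in> Mor; g \<in> Mor; tgt f = src g\<rbrakk> \<Longrightarrow> comp g f \<in> Mor"
    and src_comp: "\<lbrakk>f \<in> Mor; g \<in> Mor; tgt f = src g\<rbrakk> \<Longrightarrow> src (comp g f) = src f"
    and tgt_comp: "\<lbrakk>f \<in> Mor; g \<in> Mor; tgt f = src g\<rbrakk> \<Longrightarrow> tgt (comp g f) = tgt g"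
    and comp_ident_right: "f \<in> Mor \<Longrightarrow> comp f (ident (src f)) = f"
    and comp_ident_left: "f \<in> Mor \<Longrightarrow> comp (ident (tgt f)) f = f"
    and comp_assoc: "\<lbrakk>f \<in> Mor; g \<in> Mor; h \<in> Mor; tgt f = src g; tgt g = src h\<rbrakk>
          \<Longrightarrow> comp (comp h g) f = comp h (comp g f)"

record ('o, 'm, 'c) two_cat =
  Ob :: "'o set"
  Mor :: "'m set"
  Cell :: "'c set"
  src :: "'m \<Rightarrow> 'o"
  tgt :: "'m \<Rightarrow> 'o"
  csrc :: "'c \<Rightarrow> 'm"
  ctgt :: "'c \<Rightarrow> 'm"
  id1 :: "'o \<Rightarrow> 'm"
  id2 :: "'m \<Rightarrow> 'c"
  comp1 :: "'m \<Rightarrow> 'm \<Rightarrow> 'm"  (infixr \<open>\<odot>\<index>\<close> 70)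
  vcomp2 :: "'c \<Rightarrow> 'c \<Rightarrow> 'c"  (infixr \<open>\<circ>\<circ>\<index>\<close> 60)
  hcomp2 :: "'c \<Rightarrow> 'c \<Rightarrow> 'c"  (infixr \<open>\<star>\<index>\<close> 70)

text \<open>
  A 2-morphism \<open>\<beta> : a \<Rightarrow> b\<close> has \<open>csrc \<beta> = a\<close> and \<open>ctgt \<beta> = b\<close>. Whiskering \<open>\<beta> f\<close> is
  \<open>\<beta> \<star> id2 f\<close>, and \<open>a \<psi>\<close> is \<open>id2 a \<star> \<psi>\<close>.
\<close>

locale two_category =
  fixes X :: "('o, 'm, 'c) two_cat" (structure)
  assumes cat1: "category (Ob X) (Mor X) (src X) (tgt X) (id1 X) (comp1 X)"
    and catv: "category (Mor X) (Cell X) (csrc X) (ctgt X) (id2 X) (vcomp2 X)"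
    and cath: "category (Ob X) (Cell X) (\<lambda>\<beta>. src X (csrc X \<beta>)) (\<lambda>\<beta>. tgt X (csrc X \<beta>))
                 (\<lambda>x. id2 X (id1 X x)) (hcomp2 X)"
    and src_glob: "\<beta> \<in> Cell X \<Longrightarrow> src X (ctgt X \<beta>) = src X (csrc X \<beta>)"
    and tgt_glob: "\<beta> \<in> Cell X \<Longrightarrow> tgt X (ctgt X \<beta>) = tgt X (csrc X \<beta>)"
    and csrc_hcomp2: "\<lbrakk>\<alpha> \<in> Cell X; \<beta> \<in> Cell X; tgt X (csrc X \<alpha>) = src X (csrc X \<beta>)\<rbrakk>
          \<Longrightarrow> csrc X (\<beta> \<star> \<alpha>) = csrc X \<beta> \<odot> csrc X \<alpha>"
    and ctgt_hcomp2: "\<lbrakk>\<alpha> \<in> Cell X; \<beta> \<in> Cell X; tgt X (csrc X \<alpha>) = src X (csrc X \<beta>)\<rbrakk>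
          \<Longrightarrow> ctgt X (\<beta> \<star> \<alpha>) = ctgt X \<beta> \<odot> ctgt X \<alpha>"
    and id2_comp1: "\<lbrakk>f \<in> Mor X; g \<in> Mor X; tgt X f = src X g\<rbrakk>
          \<Longrightarrow> id2 X (g \<odot> f) = id2 X g \<star> id2 X f"
    and interchange: "\<lbrakk>\<alpha> \<in> Cell X; \<alpha>' \<in> Cell X; \<beta> \<in> Cell X; \<beta>' \<in> Cell X;
            ctgt X \<alpha> = csrc X \<alpha>'; ctgt X \<beta> = csrc X \<beta>'; tgt X (csrc X \<alpha>) = src X (csrc X \<beta>)\<rbrakk>
          \<Longrightarrow> (\<beta>' \<star> \<alpha>') \<circ>\<circ> (\<beta> \<star> \<alpha>) = (\<beta>' \<circ>\<circ> \<beta>) \<star> (\<alpha>' \<circ>\<circ> \<alpha>)"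

definition cell_invertible :: "('o, 'm, 'c) two_cat \<Rightarrow> 'c \<Rightarrow> bool" where
  "cell_invertible X \<psi> \<longleftrightarrow> \<psi> \<in> Cell X \<and>
     (\<exists>\<chi>\<in>Cell X. csrc X \<chi> = ctgt X \<psi> \<and> ctgt X \<chi> = csrc X \<psi> \<and>
        \<chi> \<circ>\<circ>\<^bsub>X\<^esub> \<psi> = id2 X (csrc X \<psi>) \<and> \<psi> \<circ>\<circ>\<^bsub>X\<^esub> \<chi> = id2 X (ctgt X \<psi>))"

definition two_functor ::
  "('o, 'm, 'c) two_cat \<Rightarrow> ('p, 'n, 'd) two_cat \<Rightarrow> ('o \<Rightarrow> 'p) \<Rightarrow> ('m \<Rightarrow> 'n) \<Rightarrow> ('c \<Rightarrow> 'd) \<Rightarrow> bool"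
  where
  "two_functor X Y F0 F1 F2 \<longleftrightarrow> two_category X \<and> two_category Y \<and>
     (\<forall>x\<in>Ob X. F0 x \<in> Ob Y \<and> F1 (id1 X x) = id1 Y (F0 x)) \<and>
     (\<forall>f\<in>Mor X. F1 f \<in> Mor Y \<and> src Y (F1 f) = F0 (src X f) \<and> tgt Y (F1 f) = F0 (tgt X f) \<and>
        F2 (id2 X f) = id2 Y (F1 f)) \<and>
     (\<forall>\<alpha>\<in>Cell X. F2 \<alpha> \<in> Cell Y \<and> csrc Y (F2 \<alpha>) = F1 (csrc X \<alpha>) \<and> ctgt Y (F2 \<alpha>) = F1 (ctgt X \<alpha>)) \<and>
     (\<forall>f\<in>Mor X. \<forall>g\<in>Mor X. tgt X f = src X g \<longrightarrow> F1 (g \<odot>\<^bsub>X\<^esub> f) = F1 g \<odot>\<^bsub>Y\<^esub> F1 f) \<and>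
     (\<forall>\<alpha>\<in>Cell X. \<forall>\<beta>\<in>Cell X. ctgt X \<alpha> = csrc X \<beta> \<longrightarrow> F2 (\<beta> \<circ>\<circ>\<^bsub>X\<^esub> \<alpha>) = F2 \<beta> \<circ>\<circ>\<^bsub>Y\<^esub> F2 \<alpha>) \<and>
     (\<forall>\<alpha>\<in>Cell X. \<forall>\<beta>\<in>Cell X. tgt X (csrc X \<alpha>) = src X (csrc X \<beta>) \<longrightarrow>
        F2 (\<beta> \<star>\<^bsub>X\<^esub> \<alpha>) = F2 \<beta> \<star>\<^bsub>Y\<^esub> F2 \<alpha>)"

definition trivial_fibration ::
  "('o, 'm, 'c) two_cat \<Rightarrow> ('p, 'n, 'd) two_cat \<Rightarrow> ('o \<Rightarrow> 'p) \<Rightarrow> ('m \<Rightarrow> 'n) \<Rightarrow> ('c \<Rightarrow> 'd) \<Rightarrow> bool"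
  where
  "trivial_fibration X Y F0 F1 F2 \<longleftrightarrow> two_functor X Y F0 F1 F2 \<and>
     (\<forall>y\<in>Ob Y. \<exists>x\<in>Ob X. F0 x = y) \<and>
     (\<forall>x\<in>Ob X. \<forall>x'\<in>Ob X. \<forall>k\<in>Mor Y. src Y k = F0 x \<and> tgt Y k = F0 x' \<longrightarrow>
        (\<exists>f\<in>Mor X. src X f = x \<and> tgt X f = x' \<and> F1 f = k)) \<and>
     (\<forall>f\<in>Mor X. \<forall>g\<in>Mor X. \<forall>\<beta>\<in>Cell Y.
        src X f = src X g \<and> tgt X f = tgt X g \<and> csrc Y \<beta> = F1 f \<and> ctgt Y \<beta> = F1 g \<longrightarrow>
        (\<exists>!\<alpha>. \<alpha> \<in> Cell X \<and> csrc X \<alpha> = f \<and> ctgt X \<alpha> = g \<and> F2 \<alpha> = \<beta>))"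


section \<open>Bi-initial objects\<close>

text \<open>
  A morphism of the pseudo-slice is stored as \<open>((A, f), (a, \<psi>), (A', f'))\<close> and a 2-morphism as
  \<open>(m, \<beta>, n)\<close>, since the pair \<open>(a, \<psi>)\<close> and the 2-morphism \<open>\<beta>\<close> do not determine their source and
  target in the pseudo-slice. The composite of \<open>(a, \<psi>)\<close> and \<open>(a', \<psi>')\<close> is \<open>(a' a, (a' \<psi>) \<circ> \<psi>')\<close>.
\<close>

type_synonym ('o, 'm, 'c) slice_mor = "('o \<times> 'm) \<times> ('m \<times> 'c) \<times> ('o \<times> 'm)"

type_synonym ('o, 'm, 'c) slice_cell =
  "('o, 'm, 'c) slice_mor \<times> 'c \<times> ('o, 'm, 'c) slice_mor"

definition slice_objs :: "('o, 'm, 'c) two_cat \<Rightarrow> 'o \<Rightarrow> ('o \<times> 'm) set" where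
  "slice_objs X I = {(A, f). A \<in> Ob X \<and> f \<in> Mor X \<and> src X f = I \<and> tgt X f = A}"

definition slice_mors :: "('o, 'm, 'c) two_cat \<Rightarrow> 'o \<Rightarrow> ('o, 'm, 'c) slice_mor set" where
  "slice_mors X I = {((A, f), (a, \<psi>), (A', f')).
     (A, f) \<in> slice_objs X I \<and> (A', f') \<in> slice_objs X I \<and>
     a \<in> Mor X \<and> src X a = A \<and> tgt X a = A' \<and>
     cell_invertible X \<psi> \<and> csrc X \<psi> = f' \<and> ctgt X \<psi> = a \<odot>\<^bsub>X\<^esub> f}"

definition slice_cells :: "('o, 'm, 'c) two_cat \<Rightarrow> 'o \<Rightarrow> ('o, 'm, 'c) slice_cell set" where
  "slice_cells X I = {(((A, f), (a, \<psi>), (A', f')), \<beta>, ((B, g), (b, \<phi>), (B', g'))).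
     ((A, f), (a, \<psi>), (A', f')) \<in> slice_mors X I \<and> ((B, g), (b, \<phi>), (B', g')) \<in> slice_mors X I \<and>
     (A, f) = (B, g) \<and> (A', f') = (B', g') \<and>
     \<beta> \<in> Cell X \<and> csrc X \<beta> = a \<and> ctgt X \<beta> = b \<and> (\<beta> \<star>\<^bsub>X\<^esub> id2 X f) \<circ>\<circ>\<^bsub>X\<^esub> \<psi> = \<phi>}"

fun slice_id1 :: "('o, 'm, 'c) two_cat \<Rightarrow> 'o \<times> 'm \<Rightarrow> ('o, 'm, 'c) slice_mor" where
  "slice_id1 X (A, f) = ((A, f), (id1 X A, id2 X f), (A, f))"

fun slice_comp1 :: "('o, 'm, 'c) two_cat \<Rightarrow> ('o, 'm, 'c) slice_mor \<Rightarrow> ('o, 'm, 'c) slice_mor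
    \<Rightarrow> ('o, 'm, 'c) slice_mor" where
  "slice_comp1 X (y, (a', \<psi>'), z) (w, (a, \<psi>), x) =
     (w, (a' \<odot>\<^bsub>X\<^esub> a, (id2 X a' \<star>\<^bsub>X\<^esub> \<psi>) \<circ>\<circ>\<^bsub>X\<^esub> \<psi>'), z)"

fun slice_id2 :: "('o, 'm, 'c) two_cat \<Rightarrow> ('o, 'm, 'c) slice_mor \<Rightarrow> ('o, 'm, 'c) slice_cell" where
  "slice_id2 X (x, (a, \<psi>), y) = ((x, (a, \<psi>), y), id2 X a, (x, (a, \<psi>), y))"

fun slice_vcomp2 :: "('o, 'm, 'c) two_cat \<Rightarrow> ('o, 'm, 'c) slice_cell \<Rightarrow> ('o, 'm, 'c) slice_cell
    \<Rightarrow> ('o, 'm, 'c) slice_cell" where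
  "slice_vcomp2 X (m', \<beta>', n') (m, \<beta>, n) = (m, \<beta>' \<circ>\<circ>\<^bsub>X\<^esub> \<beta>, n')"

fun slice_hcomp2 :: "('o, 'm, 'c) two_cat \<Rightarrow> ('o, 'm, 'c) slice_cell \<Rightarrow> ('o, 'm, 'c) slice_cell
    \<Rightarrow> ('o, 'm, 'c) slice_cell" where
  "slice_hcomp2 X (m', \<beta>', n') (m, \<beta>, n) =
     (slice_comp1 X m' m, \<beta>' \<star>\<^bsub>X\<^esub> \<beta>, slice_comp1 X n' n)"

definition pseudo_slice :: "('o, 'm, 'c) two_cat \<Rightarrow> 'o
    \<Rightarrow> ('o \<times> 'm, ('o, 'm, 'c) slice_mor, ('o, 'm, 'c) slice_cell) two_cat" where
  "pseudo_slice X I =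
     \<lparr>Ob = slice_objs X I, Mor = slice_mors X I, Cell = slice_cells X I,
      src = (\<lambda>(x, _, _). x), tgt = (\<lambda>(_, _, y). y),
      csrc = (\<lambda>(m, _, _). m), ctgt = (\<lambda>(_, _, n). n),
      id1 = slice_id1 X, id2 = slice_id2 X,
      comp1 = slice_comp1 X, vcomp2 = slice_vcomp2 X, hcomp2 = slice_hcomp2 X\<rparr>"

definition bi_initial :: "('o, 'm, 'c) two_cat \<Rightarrow> 'o \<Rightarrow> bool" where
  "bi_initial X I \<longleftrightarrow> I \<in> Ob X \<and>
     trivial_fibration (pseudo_slice X I) X
       (\<lambda>(A, _). A) (\<lambda>(_, (a, _), _). a) (\<lambda>(_, \<beta>, _). \<beta>)"


section \<open>Double categories\<close>

record ('o, 'h, 'v, 's) double_cat =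
  Obj :: "'o set"
  Hor :: "'h set"
  Ver :: "'v set"
  Sqr :: "'s set"
  hdom :: "'h \<Rightarrow> 'o"
  hcod :: "'h \<Rightarrow> 'o"
  vdom :: "'v \<Rightarrow> 'o"
  vcod :: "'v \<Rightarrow> 'o"
  sqtop :: "'s \<Rightarrow> 'h"
  sqbot :: "'s \<Rightarrow> 'h"
  sqleft :: "'s \<Rightarrow> 'v"
  sqright :: "'s \<Rightarrow> 'v"
  hid :: "'o \<Rightarrow> 'h"
  vid :: "'o \<Rightarrow> 'v"
  hidsq :: "'v \<Rightarrow> 's"
  vidsq :: "'h \<Rightarrow> 's"
  hcomp :: "'h \<Rightarrow> 'h \<Rightarrow> 'h"  (infixr \<open>\<cdot>\<index>\<close> 70)
  vcomp :: "'v \<Rightarrow> 'v \<Rightarrow> 'v"  (infixr \<open>\<bullet>\<index>\<close> 70)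
  hpaste :: "'s \<Rightarrow> 's \<Rightarrow> 's"  (infixr \<open>\<parallel>\<index>\<close> 65)
  vpaste :: "'s \<Rightarrow> 's \<Rightarrow> 's"  (infixr \<open>\<sslash>\<index>\<close> 60)

text \<open>
  Compositions of horizontal morphisms (\<open>b \<cdot> a\<close>) and of vertical morphisms (\<open>v \<bullet> u\<close>) are written
  in applicative order, but pastings of squares follow the picture: in \<open>\<alpha> \<parallel> \<beta>\<close> the square \<open>\<alpha>\<close> is to
  the left of \<open>\<beta>\<close>, and in \<open>\<sigma> \<sslash> \<tau>\<close> the square \<open>\<sigma>\<close> is above \<open>\<tau>\<close>. The square \<open>hidsq u\<close> is the identity
  for \<open>\<parallel>\<close> at the vertical morphism \<open>u\<close>, and \<open>vidsq a\<close> the identity for \<open>\<sslash>\<close> at the horizontal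
  morphism \<open>a\<close>.
\<close>

locale double_category =
  fixes A :: "('o, 'h, 'v, 's) double_cat" (structure)
  assumes cat_hor: "category (Obj A) (Hor A) (hdom A) (hcod A) (hid A) (hcomp A)"
    and cat_ver: "category (Obj A) (Ver A) (vdom A) (vcod A) (vid A) (vcomp A)"
    and cat_hpaste: "category (Ver A) (Sqr A) (sqleft A) (sqright A) (hidsq A) (\<lambda>\<beta> \<alpha>. \<alpha> \<parallel> \<beta>)"
    and cat_vpaste: "category (Hor A) (Sqr A) (sqtop A) (sqbot A) (vidsq A) (\<lambda>\<tau> \<sigma>. \<sigma> \<sslash> \<tau>)"
    and corner_top_left: "\<alpha> \<in> Sqr A \<Longrightarrow> hdom A (sqtop A \<alpha>) = vdom A (sqleft A \<alpha>)"
    and corner_top_right: "\<alpha> \<in> Sqr A \<Longrightarrow> hcod A (sqtop A \<alpha>) = vdom A (sqright A \<alpha>)"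
    and corner_bot_left: "\<alpha> \<in> Sqr A \<Longrightarrow> hdom A (sqbot A \<alpha>) = vcod A (sqleft A \<alpha>)"
    and corner_bot_right: "\<alpha> \<in> Sqr A \<Longrightarrow> hcod A (sqbot A \<alpha>) = vcod A (sqright A \<alpha>)"
    and sqtop_hidsq: "u \<in> Ver A \<Longrightarrow> sqtop A (hidsq A u) = hid A (vdom A u)"
    and sqbot_hidsq: "u \<in> Ver A \<Longrightarrow> sqbot A (hidsq A u) = hid A (vcod A u)"
    and sqleft_vidsq: "a \<in> Hor A \<Longrightarrow> sqleft A (vidsq A a) = vid A (hdom A a)"
    and sqright_vidsq: "a \<in> Hor A \<Longrightarrow> sqright A (vidsq A a) = vid A (hcod A a)"
    and sqtop_hpaste: "\<lbrakk>\<alpha> \<in> Sqr A; \<beta> \<in> Sqr A; sqright A \<alpha> = sqleft A \<beta>\<rbrakk>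
          \<Longrightarrow> sqtop A (\<alpha> \<parallel> \<beta>) = sqtop A \<beta> \<cdot> sqtop A \<alpha>"
    and sqbot_hpaste: "\<lbrakk>\<alpha> \<in> Sqr A; \<beta> \<in> Sqr A; sqright A \<alpha> = sqleft A \<beta>\<rbrakk>
          \<Longrightarrow> sqbot A (\<alpha> \<parallel> \<beta>) = sqbot A \<beta> \<cdot> sqbot A \<alpha>"
    and sqleft_vpaste: "\<lbrakk>\<sigma> \<in> Sqr A; \<tau> \<in> Sqr A; sqbot A \<sigma> = sqtop A \<tau>\<rbrakk>
          \<Longrightarrow> sqleft A (\<sigma> \<sslash> \<tau>) = sqleft A \<tau> \<bullet> sqleft A \<sigma>"
    and sqright_vpaste: "\<lbrakk>\<sigma> \<in> Sqr A; \<tau> \<in> Sqr A; sqbot A \<sigma> = sqtop A \<tau>\<rbrakk>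
          \<Longrightarrow> sqright A (\<sigma> \<sslash> \<tau>) = sqright A \<tau> \<bullet> sqright A \<sigma>"
    and hidsq_vid: "x \<in> Obj A \<Longrightarrow> hidsq A (vid A x) = vidsq A (hid A x)"
    and hidsq_vcomp: "\<lbrakk>u \<in> Ver A; v \<in> Ver A; vcod A u = vdom A v\<rbrakk>
          \<Longrightarrow> hidsq A (v \<bullet> u) = hidsq A u \<sslash> hidsq A v"
    and vidsq_hcomp: "\<lbrakk>a \<in> Hor A; b \<in> Hor A; hcod A a = hdom A b\<rbrakk>
          \<Longrightarrow> vidsq A (b \<cdot> a) = vidsq A a \<parallel> vidsq A b"
    and sq_interchange: "\<lbrakk>\<alpha> \<in> Sqr A; \<beta> \<in> Sqr A; \<gamma> \<in> Sqr A; \<delta> \<in> Sqr A;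
            sqright A \<alpha> = sqleft A \<beta>; sqright A \<gamma> = sqleft A \<delta>;
            sqbot A \<alpha> = sqtop A \<gamma>; sqbot A \<beta> = sqtop A \<delta>\<rbrakk>
          \<Longrightarrow> (\<alpha> \<parallel> \<beta>) \<sslash> (\<gamma> \<parallel> \<delta>) = (\<alpha> \<sslash> \<gamma>) \<parallel> (\<beta> \<sslash> \<delta>)"

definition vert_invertible :: "('o, 'h, 'v, 's) double_cat \<Rightarrow> 's \<Rightarrow> bool" where
  "vert_invertible A \<psi> \<longleftrightarrow> \<psi> \<in> Sqr A \<and>
     sqleft A \<psi> = vid A (hdom A (sqtop A \<psi>)) \<and> sqright A \<psi> = vid A (hcod A (sqtop A \<psi>)) \<and>
     (\<exists>\<chi>\<in>Sqr A. sqtop A \<chi> = sqbot A \<psi> \<and> sqbot A \<chi> = sqtop A \<psi> \<and>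
        sqleft A \<chi> = sqleft A \<psi> \<and> sqright A \<chi> = sqright A \<psi> \<and>
        \<psi> \<sslash>\<^bsub>A\<^esub> \<chi> = vidsq A (sqtop A \<psi>) \<and> \<chi> \<sslash>\<^bsub>A\<^esub> \<psi> = vidsq A (sqbot A \<psi>))"

definition double_functor ::
  "('o, 'h, 'v, 's) double_cat \<Rightarrow> ('p, 'k, 'w, 't) double_cat
     \<Rightarrow> ('o \<Rightarrow> 'p) \<Rightarrow> ('h \<Rightarrow> 'k) \<Rightarrow> ('v \<Rightarrow> 'w) \<Rightarrow> ('s \<Rightarrow> 't) \<Rightarrow> bool" where
  "double_functor A B F Fh Fv Fs \<longleftrightarrow> double_category A \<and> double_category B \<and>
     (\<forall>x\<in>Obj A. F x \<in> Obj B \<and> Fh (hid A x) = hid B (F x) \<and> Fv (vid A x) = vid B (F x)) \<and>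
     (\<forall>a\<in>Hor A. Fh a \<in> Hor B \<and> hdom B (Fh a) = F (hdom A a) \<and> hcod B (Fh a) = F (hcod A a) \<and>
        Fs (vidsq A a) = vidsq B (Fh a)) \<and>
     (\<forall>u\<in>Ver A. Fv u \<in> Ver B \<and> vdom B (Fv u) = F (vdom A u) \<and> vcod B (Fv u) = F (vcod A u) \<and>
        Fs (hidsq A u) = hidsq B (Fv u)) \<and>
     (\<forall>\<alpha>\<in>Sqr A. Fs \<alpha> \<in> Sqr B \<and> sqtop B (Fs \<alpha>) = Fh (sqtop A \<alpha>) \<and> sqbot B (Fs \<alpha>) = Fh (sqbot A \<alpha>) \<and>
        sqleft B (Fs \<alpha>) = Fv (sqleft A \<alpha>) \<and> sqright B (Fs \<alpha>) = Fv (sqright A \<alpha>)) \<and>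
     (\<forall>a\<in>Hor A. \<forall>b\<in>Hor A. hcod A a = hdom A b \<longrightarrow> Fh (b \<cdot>\<^bsub>A\<^esub> a) = Fh b \<cdot>\<^bsub>B\<^esub> Fh a) \<and>
     (\<forall>u\<in>Ver A. \<forall>v\<in>Ver A. vcod A u = vdom A v \<longrightarrow> Fv (v \<bullet>\<^bsub>A\<^esub> u) = Fv v \<bullet>\<^bsub>B\<^esub> Fv u) \<and>
     (\<forall>\<alpha>\<in>Sqr A. \<forall>\<beta>\<in>Sqr A. sqright A \<alpha> = sqleft A \<beta> \<longrightarrow> Fs (\<alpha> \<parallel>\<^bsub>A\<^esub> \<beta>) = Fs \<alpha> \<parallel>\<^bsub>B\<^esub> Fs \<beta>) \<and>
     (\<forall>\<sigma>\<in>Sqr A. \<forall>\<tau>\<in>Sqr A. sqbot A \<sigma> = sqtop A \<tau> \<longrightarrow> Fs (\<sigma> \<sslash>\<^bsub>A\<^esub> \<tau>) = Fs \<sigma> \<sslash>\<^bsub>B\<^esub> Fs \<tau>)"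

definition double_trivial_fibration ::
  "('o, 'h, 'v, 's) double_cat \<Rightarrow> ('p, 'k, 'w, 't) double_cat
     \<Rightarrow> ('o \<Rightarrow> 'p) \<Rightarrow> ('h \<Rightarrow> 'k) \<Rightarrow> ('v \<Rightarrow> 'w) \<Rightarrow> ('s \<Rightarrow> 't) \<Rightarrow> bool" where
  "double_trivial_fibration A B F Fh Fv Fs \<longleftrightarrow> double_functor A B F Fh Fv Fs \<and>
     (\<forall>y\<in>Obj B. \<exists>x\<in>Obj A. F x = y) \<and>
     (\<forall>x\<in>Obj A. \<forall>x'\<in>Obj A. \<forall>k\<in>Hor B. hdom B k = F x \<and> hcod B k = F x' \<longrightarrow>
        (\<exists>a\<in>Hor A. hdom A a = x \<and> hcod A a = x' \<and> Fh a = k)) \<and>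
     (\<forall>w\<in>Ver B. \<exists>u\<in>Ver A. Fv u = w) \<and>
     (\<forall>a\<in>Hor A. \<forall>b\<in>Hor A. \<forall>u\<in>Ver A. \<forall>v\<in>Ver A. \<forall>\<beta>\<in>Sqr B.
        hdom A a = vdom A u \<and> hcod A a = vdom A v \<and> hdom A b = vcod A u \<and> hcod A b = vcod A v \<and>
        sqtop B \<beta> = Fh a \<and> sqbot B \<beta> = Fh b \<and> sqleft B \<beta> = Fv u \<and> sqright B \<beta> = Fv v \<longrightarrow>
        (\<exists>!\<alpha>. \<alpha> \<in> Sqr A \<and> sqtop A \<alpha> = a \<and> sqbot A \<alpha> = b \<and> sqleft A \<alpha> = u \<and> sqright A \<alpha> = v \<and>
           Fs \<alpha> = \<beta>))"


section \<open>The 2-categories \<open>\<^bold>H\<close> and \<open>V\<close> of a double category\<close>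

definition H_two_cat :: "('o, 'h, 'v, 's) double_cat \<Rightarrow> ('o, 'h, 's) two_cat" where
  "H_two_cat A =
     \<lparr>Ob = Obj A, Mor = Hor A,
      Cell = {\<sigma> \<in> Sqr A. sqleft A \<sigma> = vid A (hdom A (sqtop A \<sigma>)) \<and>
                        sqright A \<sigma> = vid A (hcod A (sqtop A \<sigma>))},
      src = hdom A, tgt = hcod A, csrc = sqtop A, ctgt = sqbot A,
      id1 = hid A, id2 = vidsq A,
      comp1 = hcomp A,
      vcomp2 = (\<lambda>\<tau> \<sigma>. \<sigma> \<sslash>\<^bsub>A\<^esub> \<tau>),
      hcomp2 = (\<lambda>\<beta> \<alpha>. \<alpha> \<parallel>\<^bsub>A\<^esub> \<beta>)\<rparr>"

text \<open>
  A 2-morphism \<open>(\<sigma>\<^sub>0, \<sigma>\<^sub>1)\<close> from \<open>\<alpha>\<close> to \<open>\<alpha>'\<close> is stored as \<open>(\<alpha>, (\<sigma>\<^sub>0, \<sigma>\<^sub>1), \<alpha>')\<close>, since the pair does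
  not determine \<open>\<alpha>\<close> and \<open>\<alpha>'\<close>.
\<close>

definition V_cells :: "('o, 'h, 'v, 's) double_cat \<Rightarrow> ('s \<times> ('s \<times> 's) \<times> 's) set" where
  "V_cells A = {(\<alpha>, (\<sigma>\<^sub>0, \<sigma>\<^sub>1), \<alpha>').
     \<alpha> \<in> Sqr A \<and> \<alpha>' \<in> Sqr A \<and> sqleft A \<alpha> = sqleft A \<alpha>' \<and> sqright A \<alpha> = sqright A \<alpha>' \<and>
     \<sigma>\<^sub>0 \<in> Sqr A \<and> sqtop A \<sigma>\<^sub>0 = sqtop A \<alpha> \<and> sqbot A \<sigma>\<^sub>0 = sqtop A \<alpha>' \<and>
     sqleft A \<sigma>\<^sub>0 = vid A (hdom A (sqtop A \<alpha>)) \<and> sqright A \<sigma>\<^sub>0 = vid A (hcod A (sqtop A \<alpha>)) \<and>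
     \<sigma>\<^sub>1 \<in> Sqr A \<and> sqtop A \<sigma>\<^sub>1 = sqbot A \<alpha> \<and> sqbot A \<sigma>\<^sub>1 = sqbot A \<alpha>' \<and>
     sqleft A \<sigma>\<^sub>1 = vid A (hdom A (sqbot A \<alpha>)) \<and> sqright A \<sigma>\<^sub>1 = vid A (hcod A (sqbot A \<alpha>)) \<and>
     \<sigma>\<^sub>0 \<sslash>\<^bsub>A\<^esub> \<alpha>' = \<alpha> \<sslash>\<^bsub>A\<^esub> \<sigma>\<^sub>1}"

definition V_two_cat ::
  "('o, 'h, 'v, 's) double_cat \<Rightarrow> ('v, 's, 's \<times> ('s \<times> 's) \<times> 's) two_cat" where
  "V_two_cat A =
     \<lparr>Ob = Ver A, Mor = Sqr A, Cell = V_cells A,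
      src = sqleft A, tgt = sqright A,
      csrc = (\<lambda>(\<alpha>, _, _). \<alpha>), ctgt = (\<lambda>(_, _, \<alpha>'). \<alpha>'),
      id1 = hidsq A,
      id2 = (\<lambda>\<alpha>. (\<alpha>, (vidsq A (sqtop A \<alpha>), vidsq A (sqbot A \<alpha>)), \<alpha>)),
      comp1 = (\<lambda>\<beta> \<alpha>. \<alpha> \<parallel>\<^bsub>A\<^esub> \<beta>),
      vcomp2 = (\<lambda>(\<alpha>', (\<tau>\<^sub>0, \<tau>\<^sub>1), \<alpha>'') (\<alpha>, (\<sigma>\<^sub>0, \<sigma>\<^sub>1), _).
                  (\<alpha>, (\<sigma>\<^sub>0 \<sslash>\<^bsub>A\<^esub> \<tau>\<^sub>0, \<sigma>\<^sub>1 \<sslash>\<^bsub>A\<^esub> \<tau>\<^sub>1), \<alpha>'')),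
      hcomp2 = (\<lambda>(\<beta>, (\<tau>\<^sub>0, \<tau>\<^sub>1), \<beta>') (\<alpha>, (\<sigma>\<^sub>0, \<sigma>\<^sub>1), \<alpha>').
                  (\<alpha> \<parallel>\<^bsub>A\<^esub> \<beta>, (\<sigma>\<^sub>0 \<parallel>\<^bsub>A\<^esub> \<tau>\<^sub>0, \<sigma>\<^sub>1 \<parallel>\<^bsub>A\<^esub> \<tau>\<^sub>1), \<alpha>' \<parallel>\<^bsub>A\<^esub> \<beta>'))\<rparr>"


section \<open>Double bi-initial objects\<close>

text \<open>
  As above, a horizontal morphism of the pseudo-slice double category is stored as
  \<open>((A, f), (a, \<psi>), (A', f'))\<close>, and a square as \<open>(t, b, l, r, \<alpha>)\<close> with its boundary in the order top,
  bottom, left, right. A vertical morphism \<open>(u, \<gamma>)\<close> needs no annotation: it goes from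
  \<open>(vdom u, sqtop \<gamma>)\<close> to \<open>(vcod u, sqbot \<gamma>)\<close>.
\<close>

type_synonym ('o, 'h, 's) dslice_hor = "('o \<times> 'h) \<times> ('h \<times> 's) \<times> ('o \<times> 'h)"

type_synonym ('o, 'h, 'v, 's) dslice_sqr =
  "('o, 'h, 's) dslice_hor \<times> ('o, 'h, 's) dslice_hor \<times> ('v \<times> 's) \<times> ('v \<times> 's) \<times> 's"

definition dslice_objs :: "('o, 'h, 'v, 's) double_cat \<Rightarrow> 'o \<Rightarrow> ('o \<times> 'h) set" where
  "dslice_objs A I = {(X, f). X \<in> Obj A \<and> f \<in> Hor A \<and> hdom A f = I \<and> hcod A f = X}"

definition dslice_hors :: "('o, 'h, 'v, 's) double_cat \<Rightarrow> 'o \<Rightarrow> ('o, 'h, 's) dslice_hor set" where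
  "dslice_hors A I = {((X, f), (a, \<psi>), (X', f')).
     (X, f) \<in> dslice_objs A I \<and> (X', f') \<in> dslice_objs A I \<and>
     a \<in> Hor A \<and> hdom A a = X \<and> hcod A a = X' \<and>
     vert_invertible A \<psi> \<and> sqtop A \<psi> = f' \<and> sqbot A \<psi> = a \<cdot>\<^bsub>A\<^esub> f \<and>
     sqleft A \<psi> = vid A I \<and> sqright A \<psi> = vid A X'}"

definition dslice_vers :: "('o, 'h, 'v, 's) double_cat \<Rightarrow> 'o \<Rightarrow> ('v \<times> 's) set" where
  "dslice_vers A I = {(u, \<gamma>). u \<in> Ver A \<and> \<gamma> \<in> Sqr A \<and>
     (vdom A u, sqtop A \<gamma>) \<in> dslice_objs A I \<and> (vcod A u, sqbot A \<gamma>) \<in> dslice_objs A I \<and>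
     sqleft A \<gamma> = vid A I \<and> sqright A \<gamma> = u}"

definition dslice_vdom :: "('o, 'h, 'v, 's) double_cat \<Rightarrow> 'v \<times> 's \<Rightarrow> 'o \<times> 'h" where
  "dslice_vdom A = (\<lambda>(u, \<gamma>). (vdom A u, sqtop A \<gamma>))"

definition dslice_vcod :: "('o, 'h, 'v, 's) double_cat \<Rightarrow> 'v \<times> 's \<Rightarrow> 'o \<times> 'h" where
  "dslice_vcod A = (\<lambda>(u, \<gamma>). (vcod A u, sqbot A \<gamma>))"

definition dslice_sqrs :: "('o, 'h, 'v, 's) double_cat \<Rightarrow> 'o \<Rightarrow> ('o, 'h, 'v, 's) dslice_sqr set" where
  "dslice_sqrs A I =
     {((x, (a, \<psi>), x'), (y, (b, \<phi>), y'), (u, \<gamma>), (u', \<gamma>'), \<alpha>).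
        (x, (a, \<psi>), x') \<in> dslice_hors A I \<and> (y, (b, \<phi>), y') \<in> dslice_hors A I \<and>
        (u, \<gamma>) \<in> dslice_vers A I \<and> (u', \<gamma>') \<in> dslice_vers A I \<and>
        x = dslice_vdom A (u, \<gamma>) \<and> x' = dslice_vdom A (u', \<gamma>') \<and>
        y = dslice_vcod A (u, \<gamma>) \<and> y' = dslice_vcod A (u', \<gamma>') \<and>
        \<alpha> \<in> Sqr A \<and> sqtop A \<alpha> = a \<and> sqbot A \<alpha> = b \<and> sqleft A \<alpha> = u \<and> sqright A \<alpha> = u' \<and>
        \<psi> \<sslash>\<^bsub>A\<^esub> (\<gamma> \<parallel>\<^bsub>A\<^esub> \<alpha>) = \<gamma>' \<sslash>\<^bsub>A\<^esub> \<phi>}"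

fun dslice_hid :: "('o, 'h, 'v, 's) double_cat \<Rightarrow> 'o \<times> 'h \<Rightarrow> ('o, 'h, 's) dslice_hor" where
  "dslice_hid A (X, f) = ((X, f), (hid A X, vidsq A f), (X, f))"

fun dslice_hcomp :: "('o, 'h, 'v, 's) double_cat
    \<Rightarrow> ('o, 'h, 's) dslice_hor \<Rightarrow> ('o, 'h, 's) dslice_hor \<Rightarrow> ('o, 'h, 's) dslice_hor" where
  "dslice_hcomp A (y, (a', \<psi>'), z) (w, (a, \<psi>), x) =
     (w, (a' \<cdot>\<^bsub>A\<^esub> a, \<psi>' \<sslash>\<^bsub>A\<^esub> (\<psi> \<parallel>\<^bsub>A\<^esub> vidsq A a')), z)"

fun dslice_vid :: "('o, 'h, 'v, 's) double_cat \<Rightarrow> 'o \<times> 'h \<Rightarrow> 'v \<times> 's" where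
  "dslice_vid A (X, f) = (vid A X, vidsq A f)"

fun dslice_vcomp :: "('o, 'h, 'v, 's) double_cat \<Rightarrow> 'v \<times> 's \<Rightarrow> 'v \<times> 's \<Rightarrow> 'v \<times> 's" where
  "dslice_vcomp A (v, \<delta>) (u, \<gamma>) = (v \<bullet>\<^bsub>A\<^esub> u, \<gamma> \<sslash>\<^bsub>A\<^esub> \<delta>)"

fun dslice_hidsq :: "('o, 'h, 'v, 's) double_cat \<Rightarrow> 'v \<times> 's \<Rightarrow> ('o, 'h, 'v, 's) dslice_sqr" where
  "dslice_hidsq A (u, \<gamma>) =
     (dslice_hid A (dslice_vdom A (u, \<gamma>)), dslice_hid A (dslice_vcod A (u, \<gamma>)), (u, \<gamma>), (u, \<gamma>),
      hidsq A u)"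

fun dslice_vidsq :: "('o, 'h, 'v, 's) double_cat
    \<Rightarrow> ('o, 'h, 's) dslice_hor \<Rightarrow> ('o, 'h, 'v, 's) dslice_sqr" where
  "dslice_vidsq A (x, (a, \<psi>), y) =
     ((x, (a, \<psi>), y), (x, (a, \<psi>), y), dslice_vid A x, dslice_vid A y, vidsq A a)"

fun dslice_hpaste :: "('o, 'h, 'v, 's) double_cat
    \<Rightarrow> ('o, 'h, 'v, 's) dslice_sqr \<Rightarrow> ('o, 'h, 'v, 's) dslice_sqr \<Rightarrow> ('o, 'h, 'v, 's) dslice_sqr" where
  "dslice_hpaste A (t, b, l, r, \<alpha>) (t', b', l', r', \<beta>) =
     (dslice_hcomp A t' t, dslice_hcomp A b' b, l, r', \<alpha> \<parallel>\<^bsub>A\<^esub> \<beta>)"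

fun dslice_vpaste :: "('o, 'h, 'v, 's) double_cat
    \<Rightarrow> ('o, 'h, 'v, 's) dslice_sqr \<Rightarrow> ('o, 'h, 'v, 's) dslice_sqr \<Rightarrow> ('o, 'h, 'v, 's) dslice_sqr" where
  "dslice_vpaste A (t, b, l, r, \<sigma>) (t', b', l', r', \<tau>) =
     (t, b', dslice_vcomp A l' l, dslice_vcomp A r' r, \<sigma> \<sslash>\<^bsub>A\<^esub> \<tau>)"

definition double_pseudo_slice :: "('o, 'h, 'v, 's) double_cat \<Rightarrow> 'o
    \<Rightarrow> ('o \<times> 'h, ('o, 'h, 's) dslice_hor, 'v \<times> 's, ('o, 'h, 'v, 's) dslice_sqr) double_cat" where
  "double_pseudo_slice A I =
     \<lparr>Obj = dslice_objs A I, Hor = dslice_hors A I, Ver = dslice_vers A I, Sqr = dslice_sqrs A I,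
      hdom = (\<lambda>(x, _, _). x), hcod = (\<lambda>(_, _, y). y),
      vdom = dslice_vdom A, vcod = dslice_vcod A,
      sqtop = (\<lambda>(t, b, l, r, \<alpha>). t), sqbot = (\<lambda>(t, b, l, r, \<alpha>). b),
      sqleft = (\<lambda>(t, b, l, r, \<alpha>). l), sqright = (\<lambda>(t, b, l, r, \<alpha>). r),
      hid = dslice_hid A, vid = dslice_vid A, hidsq = dslice_hidsq A, vidsq = dslice_vidsq A,
      hcomp = dslice_hcomp A, vcomp = dslice_vcomp A,
      hpaste = dslice_hpaste A, vpaste = dslice_vpaste A\<rparr>"

definition double_bi_initial :: "('o, 'h, 'v, 's) double_cat \<Rightarrow> 'o \<Rightarrow> bool" where
  "double_bi_initial A I \<longleftrightarrow> I \<in> Obj A \<and>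
     double_trivial_fibration (double_pseudo_slice A I) A
       (\<lambda>(X, _). X) (\<lambda>(_, (a, _), _). a) (\<lambda>(u, _). u) (\<lambda>(_, _, _, _, \<alpha>). \<alpha>)"

section \<open>Well-definedness of the constructions\<close>

text \<open>
  The predicates \<open>trivial_fibration\<close> and \<open>double_trivial_fibration\<close> include (double) functoriality.
  The facts below show that this part always holds for the projections: the two 2-categories of a
  double category, the pseudo-slice 2-category and the pseudo-slice double category satisfy the
  respective axioms, and the projections are functors.
\<close>


context category
begin
lemma comp_ident_right': "f \<in> Mor \<Longrightarrow> src f = x \<Longrightarrow> comp f (ident x) = f"
  using comp_ident_right by blast
lemma comp_ident_left': "f \<in> Mor \<Longrightarrow> tgt f = x \<Longrightarrow> comp (ident x) f = f"
  using comp_ident_left by blast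
lemmas cat_simps = src_closed tgt_closed ident_closed src_ident tgt_ident comp_closed src_comp
  tgt_comp comp_ident_right' comp_ident_left'
end

sublocale double_category \<subseteq> hor: category "Obj A" "Hor A" "hdom A" "hcod A" "hid A" "hcomp A"
  by (rule cat_hor)
sublocale double_category \<subseteq> ver: category "Obj A" "Ver A" "vdom A" "vcod A" "vid A" "vcomp A"
  by (rule cat_ver)
sublocale double_category \<subseteq> hp: category "Ver A" "Sqr A" "sqleft A" "sqright A" "hidsq A" "\<lambda>\<beta> \<alpha>. \<alpha> \<parallel> \<beta>"
  by (rule cat_hpaste)
sublocale double_category \<subseteq> vp: category "Hor A" "Sqr A" "sqtop A" "sqbot A" "vidsq A" "\<lambda>\<tau> \<sigma>. \<sigma> \<sslash> \<tau>"
  by (rule cat_vpaste)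

context double_category
begin
lemma vidsq_hid: "x \<in> Obj A \<Longrightarrow> vidsq A (hid A x) = hidsq A (vid A x)"
  by (simp add: hidsq_vid)

lemmas dc_simps = hor.cat_simps ver.cat_simps hp.cat_simps vp.cat_simps
  corner_top_left corner_top_right corner_bot_left corner_bot_right
  sqtop_hidsq sqbot_hidsq sqleft_vidsq sqright_vidsq sqtop_hpaste sqbot_hpaste
  sqleft_vpaste sqright_vpaste vidsq_hid vidsq_hcomp hidsq_vcomp



lemma vid_vid: "x \<in> Obj A \<Longrightarrow> vid A x \<bullet> vid A x = vid A x"
  by (simp add: dc_simps)

definition globs where "globs = {\<sigma> \<in> Sqr A. \<exists>x\<in>Obj A. \<exists>y\<in>Obj A. sqleft A \<sigma> = vid A x \<and> sqright A \<sigma> = vid A y}"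

lemma H_cell_globs: "Cell (H_two_cat A) = globs"
proof (intro set_eqI iffI)
  fix \<sigma> assume "\<sigma> \<in> Cell (H_two_cat A)"
  then have s: "\<sigma> \<in> Sqr A" and l: "sqleft A \<sigma> = vid A (hdom A (sqtop A \<sigma>))"
    and r: "sqright A \<sigma> = vid A (hcod A (sqtop A \<sigma>))" by (auto simp: H_two_cat_def)
  moreover have "hdom A (sqtop A \<sigma>) \<in> Obj A" "hcod A (sqtop A \<sigma>) \<in> Obj A"
    using s by (auto intro: hor.src_closed hor.tgt_closed vp.src_closed)
  ultimately show "\<sigma> \<in> globs" unfolding globs_def by blast
next
  fix \<sigma> assume "\<sigma> \<in> globs"
  then show "\<sigma> \<in> Cell (H_two_cat A)"
    by (auto simp: globs_def H_two_cat_def corner_top_left corner_top_right ver.src_ident)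
qed

lemma globs_vert:
  assumes "\<sigma> \<in> Sqr A" "\<tau> \<in> Sqr A" "sqbot A \<sigma> = sqtop A \<tau>"
    "sqleft A \<sigma> = vid A x" "sqleft A \<tau> = vid A x'" "sqright A \<sigma> = vid A y" "sqright A \<tau> = vid A y'"
    "x \<in> Obj A" "x' \<in> Obj A" "y \<in> Obj A" "y' \<in> Obj A"
  shows "x' = x" "y' = y"
  using assms by (metis corner_bot_left corner_top_left ver.src_ident ver.tgt_ident,
    metis corner_bot_right corner_top_right ver.src_ident ver.tgt_ident)

lemma two_category_H: "two_category (H_two_cat A)"
  apply (intro two_category.intro category.intro)
  apply (simp_all only: H_cell_globs)
  apply (auto simp: H_two_cat_def globs_def dc_simps vid_vid hor.comp_assoc vp.comp_assoc hp.comp_assoc sq_interchange)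
  subgoal for f g x y xa ya using globs_vert[of f g x xa y ya] vid_vid by auto
  subgoal for f g x y xa ya using globs_vert[of f g x xa y ya] vid_vid by auto
  subgoal for \<alpha> \<alpha>' \<beta> \<beta>' x xa ya xb yb xc yc
    using globs_vert[of \<alpha> \<alpha>' x xa xb ya] globs_vert[of \<beta> \<beta>' xb xc yb yc] sq_interchange by simp
  done

lemma V_cellI:
  assumes "\<alpha> \<in> Sqr A" "\<alpha>' \<in> Sqr A" "sqleft A \<alpha> = sqleft A \<alpha>'" "sqright A \<alpha> = sqright A \<alpha>'"
    "\<sigma>\<^sub>0 \<in> Sqr A" "sqtop A \<sigma>\<^sub>0 = sqtop A \<alpha>" "sqbot A \<sigma>\<^sub>0 = sqtop A \<alpha>'"
    "sqleft A \<sigma>\<^sub>0 = vid A (vdom A (sqleft A \<alpha>))" "sqright A \<sigma>\<^sub>0 = vid A (vdom A (sqright A \<alpha>))"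
    "\<sigma>\<^sub>1 \<in> Sqr A" "sqtop A \<sigma>\<^sub>1 = sqbot A \<alpha>" "sqbot A \<sigma>\<^sub>1 = sqbot A \<alpha>'"
    "sqleft A \<sigma>\<^sub>1 = vid A (vcod A (sqleft A \<alpha>))" "sqright A \<sigma>\<^sub>1 = vid A (vcod A (sqright A \<alpha>))"
    "\<sigma>\<^sub>0 \<sslash> \<alpha>' = \<alpha> \<sslash> \<sigma>\<^sub>1"
  shows "(\<alpha>, (\<sigma>\<^sub>0, \<sigma>\<^sub>1), \<alpha>') \<in> V_cells A"
  using assms by (simp add: V_cells_def corner_top_left corner_top_right corner_bot_left corner_bot_right)

lemma V_cellE:
  assumes "s \<in> V_cells A"
  obtains \<alpha> \<alpha>' \<sigma>\<^sub>0 \<sigma>\<^sub>1 u v where "s = (\<alpha>, (\<sigma>\<^sub>0, \<sigma>\<^sub>1), \<alpha>')" "u \<in> Ver A" "v \<in> Ver A"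
    "\<alpha> \<in> Sqr A" "\<alpha>' \<in> Sqr A" "sqleft A \<alpha> = u" "sqleft A \<alpha>' = u" "sqright A \<alpha> = v" "sqright A \<alpha>' = v"
    "\<sigma>\<^sub>0 \<in> Sqr A" "sqtop A \<sigma>\<^sub>0 = sqtop A \<alpha>" "sqbot A \<sigma>\<^sub>0 = sqtop A \<alpha>'"
    "sqleft A \<sigma>\<^sub>0 = vid A (vdom A u)" "sqright A \<sigma>\<^sub>0 = vid A (vdom A v)"
    "\<sigma>\<^sub>1 \<in> Sqr A" "sqtop A \<sigma>\<^sub>1 = sqbot A \<alpha>" "sqbot A \<sigma>\<^sub>1 = sqbot A \<alpha>'"
    "sqleft A \<sigma>\<^sub>1 = vid A (vcod A u)" "sqright A \<sigma>\<^sub>1 = vid A (vcod A v)"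
    "\<sigma>\<^sub>0 \<sslash> \<alpha>' = \<alpha> \<sslash> \<sigma>\<^sub>1"
proof -
  obtain \<alpha> \<alpha>' \<sigma>\<^sub>0 \<sigma>\<^sub>1 where s: "s = (\<alpha>, (\<sigma>\<^sub>0, \<sigma>\<^sub>1), \<alpha>')" by (metis prod.exhaust)
  have "\<alpha> \<in> Sqr A" using assms by (simp add: s V_cells_def)
  then show thesis using that[OF s, of "sqleft A \<alpha>" "sqright A \<alpha>"] assms hp.src_closed hp.tgt_closed
    by (simp add: s V_cells_def corner_top_left corner_top_right corner_bot_left corner_bot_right)
qed

lemma V_sel [simp]: "Ob (V_two_cat A) = Ver A" "Mor (V_two_cat A) = Sqr A" "Cell (V_two_cat A) = V_cells A"
  "src (V_two_cat A) = sqleft A" "tgt (V_two_cat A) = sqright A"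
  "csrc (V_two_cat A) (\<alpha>, p, \<alpha>') = \<alpha>"
  "ctgt (V_two_cat A) (\<alpha>, p, \<alpha>') = \<alpha>'"
  "id1 (V_two_cat A) = hidsq A"
  "id2 (V_two_cat A) \<alpha> = (\<alpha>, (vidsq A (sqtop A \<alpha>), vidsq A (sqbot A \<alpha>)), \<alpha>)"
  "comp1 (V_two_cat A) \<beta> \<alpha> = \<alpha> \<parallel> \<beta>"
  "vcomp2 (V_two_cat A) (\<alpha>', (\<tau>\<^sub>0, \<tau>\<^sub>1), \<alpha>'') (\<alpha>, (\<sigma>\<^sub>0, \<sigma>\<^sub>1), x) =
                  (\<alpha>, (\<sigma>\<^sub>0 \<sslash> \<tau>\<^sub>0, \<sigma>\<^sub>1 \<sslash> \<tau>\<^sub>1), \<alpha>'')"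
  "hcomp2 (V_two_cat A) (\<beta>, (\<tau>\<^sub>0, \<tau>\<^sub>1), \<beta>') (\<alpha>, (\<sigma>\<^sub>0, \<sigma>\<^sub>1), \<alpha>2) =
                  (\<alpha> \<parallel> \<beta>, (\<sigma>\<^sub>0 \<parallel> \<tau>\<^sub>0, \<sigma>\<^sub>1 \<parallel> \<tau>\<^sub>1), \<alpha>2 \<parallel> \<beta>')"
  by (simp_all add: V_two_cat_def)

lemma V_vc: "\<lbrakk>s \<in> V_cells A; t \<in> V_cells A; ctgt (V_two_cat A) s = csrc (V_two_cat A) t\<rbrakk> \<Longrightarrow> t \<circ>\<circ>\<^bsub>V_two_cat A\<^esub> s \<in> V_cells A"
  apply (elim V_cellE)
  apply (simp only: V_sel)
  apply (rule V_cellI)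
  apply (simp_all add: dc_simps)
  by (metis vp.comp_assoc)

lemma V_hc: "\<lbrakk>s \<in> V_cells A; t \<in> V_cells A; sqright A (csrc (V_two_cat A) s) = sqleft A (csrc (V_two_cat A) t)\<rbrakk> \<Longrightarrow> t \<star>\<^bsub>V_two_cat A\<^esub> s \<in> V_cells A"
  apply (elim V_cellE)
  apply (simp only: V_sel)
  apply (rule V_cellI)
  apply (simp_all add: dc_simps sq_interchange)
  done

lemma V_id2: "\<alpha> \<in> Sqr A \<Longrightarrow> id2 (V_two_cat A) \<alpha> \<in> V_cells A"
  apply (simp only: V_sel)
  apply (rule V_cellI)
  apply (simp_all add: dc_simps)
  done

lemma V_id2_id1: "u \<in> Ver A \<Longrightarrow> id2 (V_two_cat A) (hidsq A u) \<in> V_cells A"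
  by (intro V_id2 hp.ident_closed)

lemma two_category_V: "two_category (V_two_cat A)"
  apply (intro two_category.intro category.intro)
  apply (simp_all only: V_vc V_hc V_id2 V_id2_id1 V_sel(1-5,8))
  apply (simp_all add: dc_simps hp.comp_assoc)
  apply (auto elim!: V_cellE simp: dc_simps vp.comp_assoc hp.comp_assoc sq_interchange)
  done
end

sublocale two_category \<subseteq> c1: category "Ob X" "Mor X" "src X" "tgt X" "id1 X" "comp1 X"
  by (rule cat1)
sublocale two_category \<subseteq> cv: category "Mor X" "Cell X" "csrc X" "ctgt X" "id2 X" "vcomp2 X"
  by (rule catv)
sublocale two_category \<subseteq> ch: category "Ob X" "Cell X" "\<lambda>\<beta>. src X (csrc X \<beta>)" "\<lambda>\<beta>. tgt X (csrc X \<beta>)"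
    "\<lambda>x. id2 X (id1 X x)" "hcomp2 X"
  by (rule cath)

context two_category
begin
lemmas tc_simps = c1.cat_simps cv.cat_simps ch.cat_simps src_glob tgt_glob csrc_hcomp2 ctgt_hcomp2
  id2_comp1

lemma whisker_left:
  assumes "a \<in> Mor X" "\<alpha> \<in> Cell X" "\<alpha>' \<in> Cell X" "ctgt X \<alpha> = csrc X \<alpha>'" "tgt X (csrc X \<alpha>) = src X a"
  shows "id2 X a \<star> (\<alpha>' \<circ>\<circ> \<alpha>) = (id2 X a \<star> \<alpha>') \<circ>\<circ> (id2 X a \<star> \<alpha>)"
  using interchange[of \<alpha> \<alpha>' "id2 X a" "id2 X a"] assms by (simp add: tc_simps)

lemma whisker_right:
  assumes "f \<in> Mor X" "\<beta> \<in> Cell X" "\<beta>' \<in> Cell X" "ctgt X \<beta> = csrc X \<beta>'" "tgt X f = src X (csrc X \<beta>)"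
  shows "(\<beta>' \<circ>\<circ> \<beta>) \<star> id2 X f = (\<beta>' \<star> id2 X f) \<circ>\<circ> (\<beta> \<star> id2 X f)"
  using interchange[of "id2 X f" "id2 X f" \<beta> \<beta>'] assms by (simp add: tc_simps)

lemma cell_invertible_id2: "f \<in> Mor X \<Longrightarrow> cell_invertible X (id2 X f)"
  unfolding cell_invertible_def by (intro conjI bexI[of _ "id2 X f"]) (simp_all add: tc_simps)

lemma cell_invertible_vcomp2:
  assumes "cell_invertible X \<psi>" "cell_invertible X \<phi>" "ctgt X \<psi> = csrc X \<phi>"
  shows "cell_invertible X (\<phi> \<circ>\<circ> \<psi>)"
proof -
  obtain \<chi> where c: "\<chi> \<in> Cell X" "csrc X \<chi> = ctgt X \<psi>" "ctgt X \<chi> = csrc X \<psi>"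
      "\<chi> \<circ>\<circ> \<psi> = id2 X (csrc X \<psi>)" "\<psi> \<circ>\<circ> \<chi> = id2 X (ctgt X \<psi>)" and p: "\<psi> \<in> Cell X"
    using assms(1) by (auto simp: cell_invertible_def)
  obtain \<xi> where x: "\<xi> \<in> Cell X" "csrc X \<xi> = ctgt X \<phi>" "ctgt X \<xi> = csrc X \<phi>"
      "\<xi> \<circ>\<circ> \<phi> = id2 X (csrc X \<phi>)" "\<phi> \<circ>\<circ> \<xi> = id2 X (ctgt X \<phi>)" and q: "\<phi> \<in> Cell X"
    using assms(2) by (auto simp: cell_invertible_def)
  have "(\<chi> \<circ>\<circ> \<xi>) \<circ>\<circ> (\<phi> \<circ>\<circ> \<psi>) = \<chi> \<circ>\<circ> (\<xi> \<circ>\<circ> \<phi>) \<circ>\<circ> \<psi>"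
    using c(1-3) p x(1-3) q assms(3) by (simp add: tc_simps cv.comp_assoc)
  also have "\<dots> = id2 X (csrc X \<psi>)"
    using c p x q assms(3) by (simp add: tc_simps)
  finally have 1: "(\<chi> \<circ>\<circ> \<xi>) \<circ>\<circ> (\<phi> \<circ>\<circ> \<psi>) = id2 X (csrc X \<psi>)" .
  have "(\<phi> \<circ>\<circ> \<psi>) \<circ>\<circ> (\<chi> \<circ>\<circ> \<xi>) = \<phi> \<circ>\<circ> (\<psi> \<circ>\<circ> \<chi>) \<circ>\<circ> \<xi>"
    using c(1-3) p x(1-3) q assms(3) by (simp add: tc_simps cv.comp_assoc)
  also have "\<dots> = id2 X (ctgt X \<phi>)"
    using c p x q assms(3) by (simp add: tc_simps)
  finally have 2: "(\<phi> \<circ>\<circ> \<psi>) \<circ>\<circ> (\<chi> \<circ>\<circ> \<xi>) = id2 X (ctgt X \<phi>)" .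
  show ?thesis unfolding cell_invertible_def
    by (intro conjI bexI[of _ "\<chi> \<circ>\<circ> \<xi>"]) (use c p x q assms(3) 1 2 in \<open>simp_all add: tc_simps\<close>)
qed

lemma cell_invertible_whisker:
  assumes "cell_invertible X \<psi>" "a \<in> Mor X" "tgt X (csrc X \<psi>) = src X a"
  shows "cell_invertible X (id2 X a \<star> \<psi>)"
proof -
  obtain \<chi> where c: "\<chi> \<in> Cell X" "csrc X \<chi> = ctgt X \<psi>" "ctgt X \<chi> = csrc X \<psi>"
      "\<chi> \<circ>\<circ> \<psi> = id2 X (csrc X \<psi>)" "\<psi> \<circ>\<circ> \<chi> = id2 X (ctgt X \<psi>)" and p: "\<psi> \<in> Cell X"
    using assms(1) by (auto simp: cell_invertible_def)
  show ?thesis unfolding cell_invertible_def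
    by (intro conjI bexI[of _ "id2 X a \<star> \<chi>"])
      (use c p assms(2,3) whisker_left[of a \<psi> \<chi>] whisker_left[of a \<chi> \<psi>] in \<open>simp_all add: tc_simps\<close>)
qed

lemma slice_sel [simp]: "Ob (pseudo_slice X I) = slice_objs X I" "Mor (pseudo_slice X I) = slice_mors X I"
  "Cell (pseudo_slice X I) = slice_cells X I"
  "src (pseudo_slice X I) (x, p, y) = x" "tgt (pseudo_slice X I) (x, p, y) = y"
  "csrc (pseudo_slice X I) (m, \<beta>, n) = m" "ctgt (pseudo_slice X I) (m, \<beta>, n) = n"
  "id1 (pseudo_slice X I) = slice_id1 X" "id2 (pseudo_slice X I) = slice_id2 X"
  "comp1 (pseudo_slice X I) = slice_comp1 X" "vcomp2 (pseudo_slice X I) = slice_vcomp2 X"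
  "hcomp2 (pseudo_slice X I) = slice_hcomp2 X"
  by (simp_all add: pseudo_slice_def)

lemma slice_morI:
  assumes "src X f = I" "tgt X f = src X a" "f \<in> Mor X" "src X f' = I" "tgt X f' = tgt X a" "f' \<in> Mor X"
     "a \<in> Mor X" "cell_invertible X \<psi>" "csrc X \<psi> = f'" "ctgt X \<psi> = a \<odot> f" "x = src X a" "x' = tgt X a"
  shows "((x, f), (a, \<psi>), (x', f')) \<in> slice_mors X I"
  using assms by (auto simp: slice_mors_def slice_objs_def tc_simps)

lemma slice_morE:
  assumes "m \<in> slice_mors X I"
  obtains x x' a f f' \<psi> where "m = ((x, f), (a, \<psi>), (x', f'))"
     "x \<in> Ob X" "x' \<in> Ob X" "src X f = I" "tgt X f = x" "f \<in> Mor X" "src X f' = I" "tgt X f' = x'" "f' \<in> Mor X"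
     "src X a = x" "tgt X a = x'"
     "a \<in> Mor X" "\<psi> \<in> Cell X" "cell_invertible X \<psi>" "csrc X \<psi> = f'" "ctgt X \<psi> = a \<odot> f"
proof -
  obtain x f a \<psi> x' f' where c: "m = ((x, f), (a, \<psi>), (x', f'))"
    by (metis prod.exhaust)
  have i: "cell_invertible X \<psi>" using assms by (simp add: c slice_mors_def)
  then have "\<psi> \<in> Cell X" by (simp add: cell_invertible_def)
  with i show thesis
    using that[OF c] assms[unfolded c slice_mors_def slice_objs_def, simplified] by blast
qed

lemma slice_cellE:
  assumes "c \<in> slice_cells X I"
  obtains x x' a b f f' \<beta> \<psi> \<phi> where "c = (((x, f), (a, \<psi>), (x', f')), \<beta>, ((x, f), (b, \<phi>), (x', f')))"
     "((x, f), (a, \<psi>), (x', f')) \<in> slice_mors X I"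
     "((x, f), (b, \<phi>), (x', f')) \<in> slice_mors X I"
     "x \<in> Ob X" "x' \<in> Ob X" "src X f = I" "tgt X f = x" "f \<in> Mor X" "src X f' = I" "tgt X f' = x'" "f' \<in> Mor X"
     "src X a = x" "tgt X a = x'" "a \<in> Mor X" "src X b = x" "tgt X b = x'" "b \<in> Mor X"
     "\<beta> \<in> Cell X" "csrc X \<beta> = a" "ctgt X \<beta> = b" "\<psi> \<in> Cell X" "csrc X \<psi> = f'" "ctgt X \<psi> = a \<odot> f"
     "\<phi> \<in> Cell X" "csrc X \<phi> = f'" "ctgt X \<phi> = b \<odot> f" "(\<beta> \<star> id2 X f) \<circ>\<circ> \<psi> = \<phi>"
proof -
  obtain x f a \<psi> x' f' \<beta> y g b \<phi> y' g' where c: "c = (((x, f), (a, \<psi>), (x', f')), \<beta>, ((y, g), (b, \<phi>), (y', g')))"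
    by (metis prod.exhaust)
  note d = assms[unfolded c slice_cells_def, simplified]
  from d have m: "((x, f), (a, \<psi>), (x', f')) \<in> slice_mors X I" and n: "((x, f), (b, \<phi>), (x', f')) \<in> slice_mors X I"
    by auto
  note mm = m[unfolded slice_mors_def slice_objs_def cell_invertible_def, simplified]
  note nn = n[unfolded slice_mors_def slice_objs_def cell_invertible_def, simplified]
  have e: "y = x" "g = f" "y' = x'" "g' = f'" using d by auto
  show thesis
    by (rule that[OF c[unfolded e] m n]) (use d mm nn in blast)+
qed

lemma slice_comp1_closed:
  assumes "m \<in> slice_mors X I" "n \<in> slice_mors X I" "tgt (pseudo_slice X I) m = src (pseudo_slice X I) n"
  shows "slice_comp1 X n m \<in> slice_mors X I"
  using assms(1)
proof (cases rule: slice_morE)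
  case m: (1 x x' a f f' \<psi>)
  show ?thesis using assms(2)
  proof (cases rule: slice_morE)
    case n: (1 y y' b g g' \<phi>)
    from assms(3) m(1) n(1) have e: "g = f'" "y = x'" by simp_all
    have i: "cell_invertible X (id2 X b \<star> \<psi>)"
      by (rule cell_invertible_whisker) (use m n e in simp_all)
    have "cell_invertible X ((id2 X b \<star> \<psi>) \<circ>\<circ> \<phi>)"
      by (rule cell_invertible_vcomp2) (use m n e i in \<open>simp_all add: tc_simps\<close>)
    then show ?thesis using m n e
      by (auto intro!: slice_morI simp: tc_simps c1.comp_assoc)
  qed
qed

lemma slice_cellI:
  assumes "((x, f), (a, \<psi>), (x', f')) \<in> slice_mors X I" "((x, f), (b, \<phi>), (x', f')) \<in> slice_mors X I"
    "\<beta> \<in> Cell X" "csrc X \<beta> = a" "ctgt X \<beta> = b" "(\<beta> \<star> id2 X f) \<circ>\<circ> \<psi> = \<phi>"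
  shows "(((x, f), (a, \<psi>), (x', f')), \<beta>, ((x, f), (b, \<phi>), (x', f'))) \<in> slice_cells X I"
  using assms by (auto simp: slice_cells_def)

lemma slice_vcomp2_closed:
  assumes "c \<in> slice_cells X I" "d \<in> slice_cells X I" "ctgt (pseudo_slice X I) c = csrc (pseudo_slice X I) d"
  shows "slice_vcomp2 X d c \<in> slice_cells X I"
  using assms(1)
proof (cases rule: slice_cellE)
  case c: (1 x x' a b f f' \<beta> \<psi> \<phi>)
  show ?thesis using assms(2)
  proof (cases rule: slice_cellE)
    case d: (1 y y' a' b' g g' \<gamma> \<psi>' \<phi>')
    from assms(3) c(1) d(1) have e: "g = f" "g' = f'" "y = x" "y' = x'" "a' = b" "\<psi>' = \<phi>" by simp_all
    have "((\<gamma> \<circ>\<circ> \<beta>) \<star> id2 X f) \<circ>\<circ> \<psi> = (\<gamma> \<star> id2 X f) \<circ>\<circ> (\<beta> \<star> id2 X f) \<circ>\<circ> \<psi>"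
      using c(4-) d(4-) e by (simp add: whisker_right cv.comp_assoc tc_simps)
    also have "\<dots> = \<phi>'" using c d e by simp
    finally have k: "((\<gamma> \<circ>\<circ> \<beta>) \<star> id2 X f) \<circ>\<circ> \<psi> = \<phi>'" .
    show ?thesis using c(2-26) d(2-26) e k unfolding c(1) d(1)
      by (auto intro!: slice_cellI simp: tc_simps)
  qed
qed

lemma slice_hcomp2_closed:
  assumes "c \<in> slice_cells X I" "d \<in> slice_cells X I"
    "tgt (pseudo_slice X I) (csrc (pseudo_slice X I) c) = src (pseudo_slice X I) (csrc (pseudo_slice X I) d)"
  shows "slice_hcomp2 X d c \<in> slice_cells X I"
  using assms(1)
proof (cases rule: slice_cellE)
  case c: (1 x x' a b f f' \<beta> \<psi> \<phi>)
  show ?thesis using assms(2)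
  proof (cases rule: slice_cellE)
    case d: (1 y y' a' b' g g' \<gamma> \<psi>' \<phi>')
    from assms(3) c(1) d(1) have e: "g = f'" "y = x'" by simp_all
    note cs = c(4-26) note ds = d(4-26)
    have "((\<gamma> \<star> \<beta>) \<star> id2 X f) \<circ>\<circ> (id2 X a' \<star> \<psi>) \<circ>\<circ> \<psi>'
        = ((\<gamma> \<star> (\<beta> \<star> id2 X f)) \<circ>\<circ> (id2 X a' \<star> \<psi>)) \<circ>\<circ> \<psi>'"
      using cs ds e by (simp add: cv.comp_assoc ch.comp_assoc tc_simps)
    also have "(\<gamma> \<star> (\<beta> \<star> id2 X f)) \<circ>\<circ> (id2 X a' \<star> \<psi>) = (\<gamma> \<circ>\<circ> id2 X a') \<star> ((\<beta> \<star> id2 X f) \<circ>\<circ> \<psi>)"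
      by (rule interchange) (use cs ds e in \<open>simp_all add: tc_simps\<close>)
    also have "\<dots> = (id2 X b' \<circ>\<circ> \<gamma>) \<star> (\<phi> \<circ>\<circ> id2 X f')"
      using cs c(27) ds e by (simp add: tc_simps)
    also have "\<dots> = (id2 X b' \<star> \<phi>) \<circ>\<circ> (\<gamma> \<star> id2 X f')"
      by (rule interchange[symmetric]) (use cs ds e in \<open>simp_all add: tc_simps\<close>)
    also have "\<dots> \<circ>\<circ> \<psi>' = (id2 X b' \<star> \<phi>) \<circ>\<circ> ((\<gamma> \<star> id2 X f') \<circ>\<circ> \<psi>')"
      using cs ds e by (simp add: cv.comp_assoc tc_simps)
    also have "\<dots> = (id2 X b' \<star> \<phi>) \<circ>\<circ> \<phi>'" using d(27) e by simp
    finally have k: "((\<gamma> \<star> \<beta>) \<star> id2 X f) \<circ>\<circ> (id2 X a' \<star> \<psi>) \<circ>\<circ> \<psi>' = (id2 X b' \<star> \<phi>) \<circ>\<circ> \<phi>'" .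
    show ?thesis
      using slice_comp1_closed[OF c(2) d(2)] slice_comp1_closed[OF c(3) d(3)] cs ds e k unfolding c(1) d(1)
      by (auto intro!: slice_cellI simp: tc_simps)
  qed
qed

lemma slice_id1_closed: "x \<in> slice_objs X I \<Longrightarrow> slice_id1 X x \<in> slice_mors X I"
  by (auto simp: slice_objs_def tc_simps cell_invertible_id2 intro!: slice_morI)

lemma slice_id2_closed: "m \<in> slice_mors X I \<Longrightarrow> slice_id2 X m \<in> slice_cells X I"
proof -
  assume m: "m \<in> slice_mors X I"
  then show ?thesis
  proof (cases rule: slice_morE)
    case (1 x x' a f f' \<psi>)
    have "(id2 X a \<star> id2 X f) \<circ>\<circ> \<psi> = id2 X (a \<odot> f) \<circ>\<circ> \<psi>" using 1 by (simp add: id2_comp1)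
    also have "\<dots> = \<psi>" using 1 by (simp add: cv.comp_ident_left')
    finally show ?thesis using 1 m by (auto intro!: slice_cellI simp: tc_simps)
  qed
qed

lemma slice_comp1_assoc:
  assumes "m \<in> slice_mors X I" "n \<in> slice_mors X I" "k \<in> slice_mors X I"
    "tgt (pseudo_slice X I) m = src (pseudo_slice X I) n"
    "tgt (pseudo_slice X I) n = src (pseudo_slice X I) k"
  shows "slice_comp1 X (slice_comp1 X k n) m = slice_comp1 X k (slice_comp1 X n m)"
  using assms(1,2,3)
  apply (elim slice_morE)
  using assms(4,5)
  apply (simp add: tc_simps c1.comp_assoc whisker_left cv.comp_assoc ch.comp_assoc)
  done

lemma id2_hcomp2: "\<lbrakk>f \<in> Mor X; g \<in> Mor X; tgt X f = src X g\<rbrakk> \<Longrightarrow> id2 X g \<star> id2 X f = id2 X (g \<odot> f)"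
  by (simp add: id2_comp1)

lemmas tc_simps' = c1.cat_simps cv.cat_simps ch.cat_simps src_glob tgt_glob csrc_hcomp2 ctgt_hcomp2
  id2_hcomp2

lemma slice_id21_closed: "x \<in> slice_objs X I \<Longrightarrow> slice_id2 X (slice_id1 X x) \<in> slice_cells X I"
  by (intro slice_id1_closed slice_id2_closed)

lemma slice_csrc_closed: "c \<in> slice_cells X I \<Longrightarrow> csrc (pseudo_slice X I) c \<in> slice_mors X I"
  by (erule slice_cellE) simp

lemma slice_ctgt_closed: "c \<in> slice_cells X I \<Longrightarrow> ctgt (pseudo_slice X I) c \<in> slice_mors X I"
  by (erule slice_cellE) simp

lemma slice_objE:
  assumes "p \<in> slice_objs X I"
  obtains x f where "p = (x, f)" "x \<in> Ob X" "f \<in> Mor X" "src X f = I" "tgt X f = x"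
  using assms by (auto simp: slice_objs_def)

lemma slice_cellE2:
  assumes "c \<in> slice_cells X I"
  obtains m n \<beta> where "c = (m, \<beta>, n)" "m \<in> slice_mors X I" "n \<in> slice_mors X I" "\<beta> \<in> Cell X"
    "src (pseudo_slice X I) n = src (pseudo_slice X I) m" "tgt (pseudo_slice X I) n = tgt (pseudo_slice X I) m"
    "src X (csrc X \<beta>) = fst (src (pseudo_slice X I) m)" "tgt X (csrc X \<beta>) = fst (tgt (pseudo_slice X I) m)"
    "csrc X \<beta> = (case m of (_, (a, _), _) \<Rightarrow> a)" "ctgt X \<beta> = (case n of (_, (a, _), _) \<Rightarrow> a)"
  using assms
proof (cases rule: slice_cellE)
  case (1 x x' a b f f' \<beta> \<psi> \<phi>)
  show thesis by (rule that[OF 1(1,2,3,18)]) (simp_all add: 1(10-20))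
qed

lemma slice_hcomp2_assoc:
  assumes "c \<in> slice_cells X I" "d \<in> slice_cells X I" "e \<in> slice_cells X I"
    "tgt (pseudo_slice X I) (csrc (pseudo_slice X I) c) = src (pseudo_slice X I) (csrc (pseudo_slice X I) d)"
    "tgt (pseudo_slice X I) (csrc (pseudo_slice X I) d) = src (pseudo_slice X I) (csrc (pseudo_slice X I) e)"
  shows "slice_hcomp2 X (slice_hcomp2 X e d) c = slice_hcomp2 X e (slice_hcomp2 X d c)"
proof -
  from assms(1) obtain m n \<beta> where c: "c = (m, \<beta>, n)" "m \<in> slice_mors X I" "n \<in> slice_mors X I" "\<beta> \<in> Cell X"
    "src (pseudo_slice X I) n = src (pseudo_slice X I) m" "tgt (pseudo_slice X I) n = tgt (pseudo_slice X I) m"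
    "src X (csrc X \<beta>) = fst (src (pseudo_slice X I) m)" "tgt X (csrc X \<beta>) = fst (tgt (pseudo_slice X I) m)"
    by (rule slice_cellE2)
  from assms(2) obtain m' n' \<beta>' where d: "d = (m', \<beta>', n')" "m' \<in> slice_mors X I" "n' \<in> slice_mors X I" "\<beta>' \<in> Cell X"
    "src (pseudo_slice X I) n' = src (pseudo_slice X I) m'" "tgt (pseudo_slice X I) n' = tgt (pseudo_slice X I) m'"
    "src X (csrc X \<beta>') = fst (src (pseudo_slice X I) m')" "tgt X (csrc X \<beta>') = fst (tgt (pseudo_slice X I) m')"
    by (rule slice_cellE2)
  from assms(3) obtain m'' n'' \<beta>'' where e: "e = (m'', \<beta>'', n'')" "m'' \<in> slice_mors X I" "n'' \<in> slice_mors X I" "\<beta>'' \<in> Cell X"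
    "src (pseudo_slice X I) n'' = src (pseudo_slice X I) m''" "tgt (pseudo_slice X I) n'' = tgt (pseudo_slice X I) m''"
    "src X (csrc X \<beta>'') = fst (src (pseudo_slice X I) m'')" "tgt X (csrc X \<beta>'') = fst (tgt (pseudo_slice X I) m'')"
    by (rule slice_cellE2)
  show ?thesis using c d e assms(4,5) by (simp add: slice_comp1_assoc ch.comp_assoc)
qed

lemma slice_interchange:
  assumes "c \<in> slice_cells X I" "c' \<in> slice_cells X I" "d \<in> slice_cells X I" "d' \<in> slice_cells X I"
    "ctgt (pseudo_slice X I) c = csrc (pseudo_slice X I) c'"
    "ctgt (pseudo_slice X I) d = csrc (pseudo_slice X I) d'"
    "tgt (pseudo_slice X I) (csrc (pseudo_slice X I) c) = src (pseudo_slice X I) (csrc (pseudo_slice X I) d)"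
  shows "slice_vcomp2 X (slice_hcomp2 X d' c') (slice_hcomp2 X d c) = slice_hcomp2 X (slice_vcomp2 X d' d) (slice_vcomp2 X c' c)"
proof -
  from assms(1) obtain m n \<beta> where c: "c = (m, \<beta>, n)" "\<beta> \<in> Cell X" "tgt X (csrc X \<beta>) = fst (tgt (pseudo_slice X I) m)"
    "ctgt X \<beta> = (case n of (_, (a, _), _) \<Rightarrow> a)"
    by (rule slice_cellE2)
  from assms(2) obtain m' n' \<beta>' where c': "c' = (m', \<beta>', n')" "\<beta>' \<in> Cell X" "csrc X \<beta>' = (case m' of (_, (a, _), _) \<Rightarrow> a)"
    by (rule slice_cellE2)
  from assms(3) obtain k l \<gamma> where d: "d = (k, \<gamma>, l)" "\<gamma> \<in> Cell X" "src X (csrc X \<gamma>) = fst (src (pseudo_slice X I) k)"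
    "ctgt X \<gamma> = (case l of (_, (a, _), _) \<Rightarrow> a)"
    by (rule slice_cellE2)
  from assms(4) obtain k' l' \<gamma>' where d': "d' = (k', \<gamma>', l')" "\<gamma>' \<in> Cell X" "csrc X \<gamma>' = (case k' of (_, (a, _), _) \<Rightarrow> a)"
    by (rule slice_cellE2)
  show ?thesis using c c' d d' assms(5-7) by (simp add: interchange)
qed

lemma two_category_pseudo_slice:
  "two_category (pseudo_slice X I)"
  apply (intro two_category.intro category.intro)
  apply (simp_all only: slice_sel slice_comp1_closed slice_vcomp2_closed slice_hcomp2_closed slice_id1_closed slice_id2_closed slice_id21_closed slice_comp1_assoc slice_csrc_closed slice_ctgt_closed slice_hcomp2_assoc slice_interchange)
  apply ((elim slice_objE slice_morE slice_cellE)?;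
      simp add: slice_objs_def tc_simps' interchange cv.comp_assoc ch.comp_assoc; fail)+
  done


lemma two_functor_pseudo_slice:
  "two_functor (pseudo_slice X I) X (\<lambda>(A, _). A) (\<lambda>(_, (a, _), _). a) (\<lambda>(_, \<beta>, _). \<beta>)"
  unfolding two_functor_def slice_sel
  apply (intro conjI ballI two_category_pseudo_slice two_category_axioms impI)
  apply ((elim slice_objE slice_morE slice_cellE)?; simp; fail)+
  done

end

context double_category
begin

interpretation H: two_category "H_two_cat A" by (rule two_category_H)

lemma H_sel [simp]: "Ob (H_two_cat A) = Obj A" "Mor (H_two_cat A) = Hor A"
  "src (H_two_cat A) = hdom A" "tgt (H_two_cat A) = hcod A"
  "csrc (H_two_cat A) = sqtop A" "ctgt (H_two_cat A) = sqbot A"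
  "id1 (H_two_cat A) = hid A" "id2 (H_two_cat A) = vidsq A" "comp1 (H_two_cat A) = hcomp A"
  "vcomp2 (H_two_cat A) \<tau> \<sigma> = \<sigma> \<sslash> \<tau>" "hcomp2 (H_two_cat A) \<beta> \<alpha> = \<alpha> \<parallel> \<beta>"
  by (simp_all add: H_two_cat_def)

lemma vert_invertible_iff: "vert_invertible A \<psi> \<longleftrightarrow> cell_invertible (H_two_cat A) \<psi>"
proof
  assume "vert_invertible A \<psi>"
  then obtain \<chi> where p: "\<psi> \<in> Sqr A"
    and lr: "sqleft A \<psi> = vid A (hdom A (sqtop A \<psi>))" "sqright A \<psi> = vid A (hcod A (sqtop A \<psi>))"
    and c: "\<chi> \<in> Sqr A" "sqtop A \<chi> = sqbot A \<psi>" "sqbot A \<chi> = sqtop A \<psi>"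
      "sqleft A \<chi> = sqleft A \<psi>" "sqright A \<chi> = sqright A \<psi>"
      "\<psi> \<sslash> \<chi> = vidsq A (sqtop A \<psi>)" "\<chi> \<sslash> \<psi> = vidsq A (sqbot A \<psi>)"
    unfolding vert_invertible_def by blast
  have "hdom A (sqtop A \<psi>) \<in> Obj A" "hcod A (sqtop A \<psi>) \<in> Obj A"
    using p by (auto intro: hor.src_closed hor.tgt_closed vp.src_closed)
  then have "\<psi> \<in> globs" "\<chi> \<in> globs"
    unfolding globs_def mem_Collect_eq c(4,5) using p lr c(1) by blast+
  with c show "cell_invertible (H_two_cat A) \<psi>"
    unfolding cell_invertible_def H_cell_globs H_sel by blast
next
  assume "cell_invertible (H_two_cat A) \<psi>"
  then obtain \<chi> where "\<psi> \<in> globs" and c: "\<chi> \<in> globs" "sqtop A \<chi> = sqbot A \<psi>" "sqbot A \<chi> = sqtop A \<psi>"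
      "\<psi> \<sslash> \<chi> = vidsq A (sqtop A \<psi>)" "\<chi> \<sslash> \<psi> = vidsq A (sqbot A \<psi>)"
    unfolding cell_invertible_def H_sel H_cell_globs by blast
  then obtain x y x' y' where p: "\<psi> \<in> Sqr A" "x \<in> Obj A" "y \<in> Obj A" "sqleft A \<psi> = vid A x" "sqright A \<psi> = vid A y"
    and q: "\<chi> \<in> Sqr A" "x' \<in> Obj A" "y' \<in> Obj A" "sqleft A \<chi> = vid A x'" "sqright A \<chi> = vid A y'"
    by (auto simp: globs_def)
  have "x' = x" "y' = y" using globs_vert[of \<psi> \<chi> x x' y y'] p q c by simp_all
  with p q c show "vert_invertible A \<psi>"
    unfolding vert_invertible_def by (intro conjI bexI[of _ \<chi>]) (simp_all add: dc_simps)
qed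

lemma dslice_objs_eq: "dslice_objs A I = slice_objs (H_two_cat A) I"
  by (simp add: dslice_objs_def slice_objs_def)

lemma dslice_hors_eq: "dslice_hors A I = slice_mors (H_two_cat A) I"
proof -
  have "sqleft A \<psi> = vid A (hdom A (sqtop A \<psi>)) \<and> sqright A \<psi> = vid A (hcod A (sqtop A \<psi>))" if "vert_invertible A \<psi>" for \<psi>
    using that by (simp add: vert_invertible_def)
  then show ?thesis
    unfolding dslice_hors_def slice_mors_def dslice_objs_eq vert_invertible_iff[symmetric] H_sel
    by (auto simp: slice_objs_def)
qed

lemma dslice_hcomp_eq: "dslice_hcomp A = slice_comp1 (H_two_cat A)"
  by (intro ext) (auto simp: split_paired_all)

lemma dslice_hid_eq: "dslice_hid A = slice_id1 (H_two_cat A)"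
  by (intro ext) (auto simp: split_paired_all)

lemma category_dslice_hor:
  "category (dslice_objs A I) (dslice_hors A I) (\<lambda>(x, _, _). x) (\<lambda>(_, _, y). y) (dslice_hid A) (dslice_hcomp A)"
  using two_category.cat1[OF H.two_category_pseudo_slice[of I]]
  unfolding dslice_objs_eq dslice_hors_eq dslice_hcomp_eq dslice_hid_eq
  by (simp add: pseudo_slice_def)

lemma dslice_horE:
  assumes "m \<in> dslice_hors A I"
  obtains x x' a f f' \<psi> where "m = ((x, f), (a, \<psi>), (x', f'))" "I \<in> Obj A"
     "x \<in> Obj A" "x' \<in> Obj A" "hdom A f = I" "hcod A f = x" "f \<in> Hor A" "hdom A f' = I" "hcod A f' = x'" "f' \<in> Hor A"
     "hdom A a = x" "hcod A a = x'"
     "a \<in> Hor A" "\<psi> \<in> Sqr A" "sqtop A \<psi> = f'" "sqbot A \<psi> = a \<cdot> f" "sqleft A \<psi> = vid A I" "sqright A \<psi> = vid A x'"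
proof -
  obtain x f a \<psi> x' f' where c: "m = ((x, f), (a, \<psi>), (x', f'))"
    by (metis prod.exhaust)
  have i: "vert_invertible A \<psi>" using assms by (simp add: c dslice_hors_def)
  then have p: "\<psi> \<in> Sqr A" by (simp add: vert_invertible_def)
  have "I \<in> Obj A" using assms hor.src_closed by (auto simp: c dslice_hors_def dslice_objs_def)
  with p show thesis
    using that[OF c] assms[unfolded c dslice_hors_def dslice_objs_def, simplified] by blast
qed

lemma dslice_verE:
  assumes "m \<in> dslice_vers A I"
  obtains u \<gamma> x y f g where "m = (u, \<gamma>)" "I \<in> Obj A" "x \<in> Obj A" "y \<in> Obj A"
    "u \<in> Ver A" "vdom A u = x" "vcod A u = y" "\<gamma> \<in> Sqr A" "sqleft A \<gamma> = vid A I" "sqright A \<gamma> = u"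
    "sqtop A \<gamma> = f" "sqbot A \<gamma> = g" "f \<in> Hor A" "g \<in> Hor A" "hdom A f = I" "hcod A f = x"
    "hdom A g = I" "hcod A g = y" "dslice_vdom A m = (x, f)" "dslice_vcod A m = (y, g)"
proof -
  obtain u \<gamma> where m: "m = (u, \<gamma>)" by (cases m)
  note d = assms[unfolded m dslice_vers_def dslice_objs_def, simplified]
  have I: "I \<in> Obj A" using d hor.src_closed by blast
  show thesis
    by (rule that[OF m I, of "vdom A u" "vcod A u" "sqtop A \<gamma>" "sqbot A \<gamma>"])
      (use d in \<open>simp_all add: m dslice_vdom_def dslice_vcod_def\<close>)
qed

lemma dslice_verI:
  assumes "u \<in> Ver A" "\<gamma> \<in> Sqr A" "sqleft A \<gamma> = vid A I" "sqright A \<gamma> = u" "I \<in> Obj A"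
  shows "(u, \<gamma>) \<in> dslice_vers A I"
  using assms by (simp add: dslice_vers_def dslice_objs_def dc_simps)

lemma category_dslice_ver:
  "category (dslice_objs A I) (dslice_vers A I) (dslice_vdom A) (dslice_vcod A) (dslice_vid A) (dslice_vcomp A)"
  apply (intro category.intro)
            apply (elim dslice_verE; simp add: dslice_objs_def; fail)
           apply (elim dslice_verE; simp add: dslice_objs_def; fail)
          apply (clarsimp simp: dslice_objs_def; intro dslice_verI; simp add: dc_simps; fail)
         apply (clarsimp simp: dslice_objs_def dslice_vdom_def dc_simps; fail)
        apply (clarsimp simp: dslice_objs_def dslice_vcod_def dc_simps; fail)
       apply (elim dslice_verE; simp; intro dslice_verI; simp add: dc_simps; fail)
      apply (elim dslice_verE; simp; simp add: dslice_vdom_def dc_simps; fail)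
     apply (elim dslice_verE; simp; simp add: dslice_vcod_def dc_simps; fail)
    apply (elim dslice_verE; simp add: dc_simps; fail)
   apply (elim dslice_verE; simp add: dc_simps; fail)
  apply (elim dslice_verE; simp add: dc_simps ver.comp_assoc vp.comp_assoc; fail)
  done

lemma dslice_sqrE:
  assumes "s \<in> dslice_sqrs A I"
  obtains \<alpha> a b f f' g g' x x' y y' \<psi> \<phi> u u' \<gamma> \<gamma>' where
    "s = (((x, f), (a, \<psi>), (x', f')), ((y, g), (b, \<phi>), (y', g')), (u, \<gamma>), (u', \<gamma>'), \<alpha>)"
    "((x, f), (a, \<psi>), (x', f')) \<in> dslice_hors A I" "((y, g), (b, \<phi>), (y', g')) \<in> dslice_hors A I"
    "(u, \<gamma>) \<in> dslice_vers A I" "(u', \<gamma>') \<in> dslice_vers A I"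
    "I \<in> Obj A" "x \<in> Obj A" "x' \<in> Obj A" "y \<in> Obj A" "y' \<in> Obj A"
    "vdom A u = x" "vdom A u' = x'" "vcod A u = y" "vcod A u' = y'"
    "sqtop A \<gamma> = f" "sqtop A \<gamma>' = f'" "sqbot A \<gamma> = g" "sqbot A \<gamma>' = g'"
    "a \<in> Hor A" "b \<in> Hor A" "hdom A a = x" "hcod A a = x'" "hdom A b = y" "hcod A b = y'"
    "\<alpha> \<in> Sqr A" "sqtop A \<alpha> = a" "sqbot A \<alpha> = b" "sqleft A \<alpha> = u" "sqright A \<alpha> = u'"
    "\<psi> \<in> Sqr A" "sqtop A \<psi> = f'" "sqbot A \<psi> = a \<cdot> f" "sqleft A \<psi> = vid A I" "sqright A \<psi> = vid A x'"
    "\<phi> \<in> Sqr A" "sqtop A \<phi> = g'" "sqbot A \<phi> = b \<cdot> g" "sqleft A \<phi> = vid A I" "sqright A \<phi> = vid A y'"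
    "\<gamma> \<in> Sqr A" "sqleft A \<gamma> = vid A I" "sqright A \<gamma> = u"
    "\<gamma>' \<in> Sqr A" "sqleft A \<gamma>' = vid A I" "sqright A \<gamma>' = u'"
    "u \<in> Ver A" "u' \<in> Ver A"
    "f \<in> Hor A" "f' \<in> Hor A" "g \<in> Hor A" "g' \<in> Hor A"
    "hdom A f = I" "hcod A f = x" "hdom A f' = I" "hcod A f' = x'"
    "hdom A g = I" "hcod A g = y" "hdom A g' = I" "hcod A g' = y'"
    "\<psi> \<sslash> (\<gamma> \<parallel> \<alpha>) = \<gamma>' \<sslash> \<phi>"
proof -
  obtain x f a \<psi> x' f' y g b \<phi> y' g' u \<gamma> u' \<gamma>' \<alpha> where
    s: "s = (((x, f), (a, \<psi>), (x', f')), ((y, g), (b, \<phi>), (y', g')), (u, \<gamma>), (u', \<gamma>'), \<alpha>)"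
    by (metis prod.exhaust)
  note d = assms[unfolded s dslice_sqrs_def dslice_vdom_def dslice_vcod_def, simplified]
  have h: "((x, f), (a, \<psi>), (x', f')) \<in> dslice_hors A I" "((y, g), (b, \<phi>), (y', g')) \<in> dslice_hors A I"
    "(u, \<gamma>) \<in> dslice_vers A I" "(u', \<gamma>') \<in> dslice_vers A I" using d by blast+
  have i: "I \<in> Obj A" using h(1) by (rule dslice_horE)
  note h1 = h(1)[unfolded dslice_hors_def dslice_objs_def vert_invertible_def, simplified]
  note h2 = h(2)[unfolded dslice_hors_def dslice_objs_def vert_invertible_def, simplified]
  note h3 = h(3)[unfolded dslice_vers_def dslice_objs_def, simplified]
  note h4 = h(4)[unfolded dslice_vers_def dslice_objs_def, simplified]
  from d h1 h2 h3 h4 show thesis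
    apply (elim conjE)
    apply (rule that[OF s h i])
    apply (assumption | rule sym, assumption)+
    done
qed

lemma dslice_sqrI:
  assumes "t \<in> dslice_hors A I" "b \<in> dslice_hors A I" "l \<in> dslice_vers A I" "r \<in> dslice_vers A I"
    "fst t = dslice_vdom A l" "snd (snd t) = dslice_vdom A r" "fst b = dslice_vcod A l" "snd (snd b) = dslice_vcod A r"
    "\<alpha> \<in> Sqr A" "sqtop A \<alpha> = fst (fst (snd t))" "sqbot A \<alpha> = fst (fst (snd b))" "sqleft A \<alpha> = fst l" "sqright A \<alpha> = fst r"
    "snd (fst (snd t)) \<sslash> (snd l \<parallel> \<alpha>) = snd r \<sslash> snd (fst (snd b))"
  shows "(t, b, l, r, \<alpha>) \<in> dslice_sqrs A I"
proof -
  obtain x f a \<psi> x' f' y g c \<phi> y' g' u \<gamma> u' \<gamma>' where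
    "t = ((x, f), (a, \<psi>), (x', f'))" "b = ((y, g), (c, \<phi>), (y', g'))" "l = (u, \<gamma>)" "r = (u', \<gamma>')"
    by (metis prod.exhaust)
  then show ?thesis using assms by (simp add: dslice_sqrs_def)
qed

lemma dslice_hpaste_eq:
  assumes "\<psi> \<in> Sqr A" "\<psi>' \<in> Sqr A" "\<phi> \<in> Sqr A" "\<phi>' \<in> Sqr A" "\<gamma> \<in> Sqr A" "\<gamma>' \<in> Sqr A" "\<gamma>'' \<in> Sqr A"
    "\<alpha> \<in> Sqr A" "\<beta> \<in> Sqr A"
    and a: "\<psi> \<sslash> (\<gamma> \<parallel> \<alpha>) = \<gamma>' \<sslash> \<phi>" and b: "\<psi>' \<sslash> (\<gamma>' \<parallel> \<beta>) = \<gamma>'' \<sslash> \<phi>'"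
    and "sqbot A \<psi> = sqtop A \<alpha> \<cdot> sqtop A \<gamma>" "sqright A \<gamma> = sqleft A \<alpha>" "sqbot A \<gamma>' = sqtop A \<phi>"
    "sqbot A \<psi>' = sqtop A \<beta> \<cdot> sqtop A \<gamma>'" "sqright A \<gamma>' = sqleft A \<beta>" "sqright A \<alpha> = sqleft A \<beta>"
    "sqbot A \<gamma>'' = sqtop A \<phi>'" "sqtop A \<psi> = sqtop A \<gamma>'"
    "sqright A \<psi> = vid A (vdom A (sqleft A \<beta>))" "sqright A \<phi> = vid A (vcod A (sqleft A \<beta>))"
    "sqbot A \<phi>' = sqbot A \<beta> \<cdot> sqtop A \<phi>"
  shows "(\<psi>' \<sslash> (\<psi> \<parallel> vidsq A (sqtop A \<beta>))) \<sslash> (\<gamma> \<parallel> (\<alpha> \<parallel> \<beta>)) = \<gamma>'' \<sslash> (\<phi>' \<sslash> (\<phi> \<parallel> vidsq A (sqbot A \<beta>)))"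
proof -
  have "(\<psi>' \<sslash> (\<psi> \<parallel> vidsq A (sqtop A \<beta>))) \<sslash> (\<gamma> \<parallel> (\<alpha> \<parallel> \<beta>)) = \<psi>' \<sslash> ((\<psi> \<parallel> vidsq A (sqtop A \<beta>)) \<sslash> ((\<gamma> \<parallel> \<alpha>) \<parallel> \<beta>))"
    using assms by (simp add: vp.comp_assoc hp.comp_assoc dc_simps)
  also have "(\<psi> \<parallel> vidsq A (sqtop A \<beta>)) \<sslash> ((\<gamma> \<parallel> \<alpha>) \<parallel> \<beta>) = (\<psi> \<sslash> (\<gamma> \<parallel> \<alpha>)) \<parallel> (vidsq A (sqtop A \<beta>) \<sslash> \<beta>)"
    by (rule sq_interchange) (use assms in \<open>simp_all add: dc_simps\<close>)
  also have "\<dots> = (\<gamma>' \<sslash> \<phi>) \<parallel> (\<beta> \<sslash> vidsq A (sqbot A \<beta>))" using assms by (simp add: dc_simps)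
  also have "\<dots> = (\<gamma>' \<parallel> \<beta>) \<sslash> (\<phi> \<parallel> vidsq A (sqbot A \<beta>))"
    by (rule sq_interchange[symmetric]) (use assms in \<open>simp_all add: dc_simps\<close>)
  also have "\<psi>' \<sslash> \<dots> = (\<psi>' \<sslash> (\<gamma>' \<parallel> \<beta>)) \<sslash> (\<phi> \<parallel> vidsq A (sqbot A \<beta>))"
    using assms by (simp add: vp.comp_assoc dc_simps)
  also have "\<dots> = \<gamma>'' \<sslash> (\<phi>' \<sslash> (\<phi> \<parallel> vidsq A (sqbot A \<beta>)))"
    unfolding b using assms by (simp add: vp.comp_assoc dc_simps)
  finally show ?thesis .
qed

end

context double_category
begin

lemma dslice_sel [simp]:
  "Obj (double_pseudo_slice A I) = dslice_objs A I" "Hor (double_pseudo_slice A I) = dslice_hors A I"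
  "Ver (double_pseudo_slice A I) = dslice_vers A I" "Sqr (double_pseudo_slice A I) = dslice_sqrs A I"
  "hdom (double_pseudo_slice A I) (x, p, y) = x" "hcod (double_pseudo_slice A I) (x, p, y) = y"
  "vdom (double_pseudo_slice A I) = dslice_vdom A" "vcod (double_pseudo_slice A I) = dslice_vcod A"
  "sqtop (double_pseudo_slice A I) (t, b, l, r, \<alpha>) = t" "sqbot (double_pseudo_slice A I) (t, b, l, r, \<alpha>) = b"
  "sqleft (double_pseudo_slice A I) (t, b, l, r, \<alpha>) = l" "sqright (double_pseudo_slice A I) (t, b, l, r, \<alpha>) = r"
  "hid (double_pseudo_slice A I) = dslice_hid A" "vid (double_pseudo_slice A I) = dslice_vid A"
  "hidsq (double_pseudo_slice A I) = dslice_hidsq A" "vidsq (double_pseudo_slice A I) = dslice_vidsq A"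
  "hcomp (double_pseudo_slice A I) = dslice_hcomp A" "vcomp (double_pseudo_slice A I) = dslice_vcomp A"
  "hpaste (double_pseudo_slice A I) = dslice_hpaste A" "vpaste (double_pseudo_slice A I) = dslice_vpaste A"
  by (simp_all add: double_pseudo_slice_def)

lemma dslice_hcomp_closed:
  assumes "(x, p, y) \<in> dslice_hors A I" "(y, q, z) \<in> dslice_hors A I"
  shows "dslice_hcomp A (y, q, z) (x, p, y) \<in> dslice_hors A I"
  using category.comp_closed[OF category_dslice_hor assms] by simp

lemma dslice_hpaste_closed:
  assumes "s \<in> dslice_sqrs A I" "t \<in> dslice_sqrs A I"
    "sqright (double_pseudo_slice A I) s = sqleft (double_pseudo_slice A I) t"
  shows "dslice_hpaste A s t \<in> dslice_sqrs A I"
  using assms(1)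
proof (cases rule: dslice_sqrE)
  case s: (1 \<alpha> a b f f' g g' x x' y y' \<psi> \<phi> u u' \<gamma> \<gamma>')
  show ?thesis using assms(2)
  proof (cases rule: dslice_sqrE)
    case t: (1 \<beta> a2 b2 f2 f'' g2 g'' x2 x'' y2 y'' \<psi>' \<phi>' u2 u'' \<gamma>2 \<gamma>'')
    have e0: "u2 = u'" "\<gamma>2 = \<gamma>'" using assms(3) s(1) t(1) by simp_all
    have e: "u2 = u'" "\<gamma>2 = \<gamma>'" "x2 = x'" "y2 = y'" "f2 = f'" "g2 = g'"
      using e0 s(11-18) t(11-18) by simp_all
    have k: "(\<psi>' \<sslash> (\<psi> \<parallel> vidsq A (sqtop A \<beta>))) \<sslash> (\<gamma> \<parallel> (\<alpha> \<parallel> \<beta>)) = \<gamma>'' \<sslash> (\<phi>' \<sslash> (\<phi> \<parallel> vidsq A (sqbot A \<beta>)))"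
      by (rule dslice_hpaste_eq[where \<gamma>' = \<gamma>']) (simp_all add: s(6-) t(6-)[unfolded e] dc_simps)
    show ?thesis unfolding s(1) t(1) dslice_hpaste.simps
      apply (rule dslice_sqrI)
      using dslice_hcomp_closed[OF s(2) t(2)[unfolded e]] dslice_hcomp_closed[OF s(3) t(3)[unfolded e]] s(4) t(5) k
      by (simp_all add: s(6-59) t(6-59)[unfolded e] e(1,2) dslice_vdom_def dslice_vcod_def dc_simps)
  qed
qed

lemma dslice_vpaste_closed:
  assumes "s \<in> dslice_sqrs A I" "t \<in> dslice_sqrs A I"
    "sqbot (double_pseudo_slice A I) s = sqtop (double_pseudo_slice A I) t"
  shows "dslice_vpaste A s t \<in> dslice_sqrs A I"
  using assms(1)
proof (cases rule: dslice_sqrE)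
  case s: (1 \<alpha> a b f f' g g' x x' y y' \<psi> \<phi> u u' \<gamma> \<gamma>')
  show ?thesis using assms(2)
  proof (cases rule: dslice_sqrE)
    case t: (1 \<beta> a2 c f2 f2' h h' x2 x2' z z' \<psi>2 \<chi> v v' \<delta> \<delta>')
    have e: "a2 = b" "\<psi>2 = \<phi>" "x2 = y" "x2' = y'" "f2 = g" "f2' = g'" using assms(3) s(1) t(1) by simp_all
    have "\<psi> \<sslash> ((\<gamma> \<sslash> \<delta>) \<parallel> (\<alpha> \<sslash> \<beta>)) = \<psi> \<sslash> ((\<gamma> \<parallel> \<alpha>) \<sslash> (\<delta> \<parallel> \<beta>))"
      using s(6-) t(6-) e by (simp add: sq_interchange)
    also have "\<dots> = (\<psi> \<sslash> (\<gamma> \<parallel> \<alpha>)) \<sslash> (\<delta> \<parallel> \<beta>)"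
      using s(6-59) t(6-59) e by (simp add: vp.comp_assoc dc_simps)
    also have "\<dots> = \<gamma>' \<sslash> (\<phi> \<sslash> (\<delta> \<parallel> \<beta>))"
      unfolding s(60) using s(6-59) t(6-59) e by (simp add: vp.comp_assoc dc_simps)
    also have "\<dots> = (\<gamma>' \<sslash> \<delta>') \<sslash> \<chi>"
      using t(60) e s(6-59) t(6-59) by (simp add: vp.comp_assoc dc_simps)
    finally have k: "\<psi> \<sslash> ((\<gamma> \<sslash> \<delta>) \<parallel> (\<alpha> \<sslash> \<beta>)) = (\<gamma>' \<sslash> \<delta>') \<sslash> \<chi>" .
    show ?thesis unfolding s(1) t(1) dslice_vpaste.simps
      apply (rule dslice_sqrI)
      using s(2) t(3) k
      by (simp_all add: s(6-59) t(6-59)[unfolded e] dslice_vdom_def dslice_vcod_def dc_simps dslice_verI)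
  qed
qed

lemma dslice_hid_closed: "x \<in> dslice_objs A I \<Longrightarrow> dslice_hid A x \<in> dslice_hors A I"
  by (rule category.ident_closed[OF category_dslice_hor])

lemma dslice_vid_closed: "x \<in> dslice_objs A I \<Longrightarrow> dslice_vid A x \<in> dslice_vers A I"
  by (rule category.ident_closed[OF category_dslice_ver])

lemma dslice_hidsq_closed:
  assumes "l \<in> dslice_vers A I" shows "dslice_hidsq A l \<in> dslice_sqrs A I"
  using assms
proof (cases rule: dslice_verE)
  case (1 u \<gamma> x y f g)
  have "dslice_hid A (dslice_vdom A l) \<in> dslice_hors A I" "dslice_hid A (dslice_vcod A l) \<in> dslice_hors A I"
    using assms by (auto intro!: dslice_hid_closed simp: dslice_vers_def dslice_vdom_def dslice_vcod_def)
  then show ?thesis using assms 1(2-18) unfolding 1(1) dslice_hidsq.simps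
    apply (intro dslice_sqrI)
    by (simp_all add: dslice_vdom_def dslice_vcod_def dc_simps)
qed

lemma dslice_vidsq_closed:
  assumes "t \<in> dslice_hors A I" shows "dslice_vidsq A t \<in> dslice_sqrs A I"
  using assms
proof (cases rule: dslice_horE)
  case (1 x x' a f f' \<psi>)
  have "dslice_vid A (x, f) \<in> dslice_vers A I" "dslice_vid A (x', f') \<in> dslice_vers A I"
    by (rule dslice_vid_closed, use 1(2-18) in \<open>simp add: dslice_objs_def\<close>)+
  moreover have "\<psi> \<sslash> (vidsq A f \<parallel> vidsq A a) = \<psi>"
    using 1(2-18) by (simp add: vidsq_hcomp[symmetric] vp.comp_ident_right' vp.comp_ident_left')
  moreover have "vidsq A f' \<sslash> \<psi> = \<psi>" using 1(2-18) by (simp add: vp.comp_ident_right')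
  ultimately show ?thesis using assms 1(2-18) unfolding 1(1) dslice_vidsq.simps
    apply (intro dslice_sqrI)
    by (simp_all add: dslice_vdom_def dslice_vcod_def dc_simps)
qed


lemma dslice_sqrE2:
  assumes "s \<in> dslice_sqrs A I"
  obtains t b l r \<alpha> where "s = (t, b, l, r, \<alpha>)" "t \<in> dslice_hors A I" "b \<in> dslice_hors A I"
    "l \<in> dslice_vers A I" "r \<in> dslice_vers A I"
    "fst t = dslice_vdom A l" "snd (snd t) = dslice_vdom A r" "fst b = dslice_vcod A l" "snd (snd b) = dslice_vcod A r"
    "\<alpha> \<in> Sqr A" "sqtop A \<alpha> = fst (fst (snd t))" "sqbot A \<alpha> = fst (fst (snd b))" "sqleft A \<alpha> = fst l" "sqright A \<alpha> = fst r"
proof -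
  obtain x f a \<psi> x' f' y g b \<phi> y' g' u \<gamma> u' \<gamma>' \<alpha> where
    s: "s = (((x, f), (a, \<psi>), (x', f')), ((y, g), (b, \<phi>), (y', g')), (u, \<gamma>), (u', \<gamma>'), \<alpha>)"
    by (metis prod.exhaust)
  note d = assms[unfolded s dslice_sqrs_def, simplified]
  have "((x, f), (a, \<psi>), (x', f')) \<in> dslice_hors A I" "((y, g), (b, \<phi>), (y', g')) \<in> dslice_hors A I"
    using d by blast+
  then show thesis by (rule that[OF s]) (use d in simp_all)
qed

lemma category_dslice_hpaste:
  "category (dslice_vers A I) (dslice_sqrs A I) (sqleft (double_pseudo_slice A I)) (sqright (double_pseudo_slice A I))
    (dslice_hidsq A) (\<lambda>\<beta> \<alpha>. dslice_hpaste A \<alpha> \<beta>)"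
proof -
  interpret h: category "dslice_objs A I" "dslice_hors A I" "\<lambda>(x, _, _). x" "\<lambda>(_, _, y). y" "dslice_hid A" "dslice_hcomp A"
    by (rule category_dslice_hor)
  show ?thesis
    apply (intro category.intro)
    subgoal by (elim dslice_sqrE; simp)
    subgoal by (elim dslice_sqrE; simp)
    subgoal by (rule dslice_hidsq_closed)
    subgoal by (elim dslice_verE; simp)
    subgoal by (elim dslice_verE; simp)
    subgoal by (rule dslice_hpaste_closed)
    subgoal by (elim dslice_sqrE; simp)
    subgoal by (elim dslice_sqrE; simp)
    subgoal for s
      apply (elim dslice_sqrE)
      subgoal for \<alpha> a b f f' g g' x x' y y' \<psi> \<phi>
        using h.comp_ident_right[of "((x, f), (a, \<psi>), (x', f'))"] h.comp_ident_right[of "((y, g), (b, \<phi>), (y', g'))"]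
        by (simp add: dslice_vdom_def dslice_vcod_def dc_simps)
      done
    subgoal for s
      apply (elim dslice_sqrE)
      subgoal for \<alpha> a b f f' g g' x x' y y' \<psi> \<phi>
        using h.comp_ident_left[of "((x, f), (a, \<psi>), (x', f'))"] h.comp_ident_left[of "((y, g), (b, \<phi>), (y', g'))"]
        by (simp add: dslice_vdom_def dslice_vcod_def dc_simps)
      done
    subgoal for s t k
      apply (elim dslice_sqrE2)
      apply (simp add: h.comp_assoc hp.comp_assoc split_beta)
      done
    done
qed

lemma category_dslice_vpaste:
  "category (dslice_hors A I) (dslice_sqrs A I) (sqtop (double_pseudo_slice A I)) (sqbot (double_pseudo_slice A I))
    (dslice_vidsq A) (\<lambda>\<beta> \<alpha>. dslice_vpaste A \<alpha> \<beta>)"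
proof -
  interpret v: category "dslice_objs A I" "dslice_vers A I" "dslice_vdom A" "dslice_vcod A" "dslice_vid A" "dslice_vcomp A"
    by (rule category_dslice_ver)
  show ?thesis
    apply (intro category.intro)
    subgoal by (elim dslice_sqrE; simp)
    subgoal by (elim dslice_sqrE; simp)
    subgoal by (rule dslice_vidsq_closed)
    subgoal by (elim dslice_horE; simp)
    subgoal by (elim dslice_horE; simp)
    subgoal by (rule dslice_vpaste_closed)
    subgoal by (elim dslice_sqrE; simp)
    subgoal by (elim dslice_sqrE; simp)
    subgoal by (elim dslice_sqrE2) (auto simp: split_beta vp.comp_ident_right' v.comp_ident_right')
    subgoal by (elim dslice_sqrE2) (auto simp: split_beta vp.comp_ident_left' v.comp_ident_left')
    subgoal by (elim dslice_sqrE2) (simp add: v.comp_assoc vp.comp_assoc)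
    done
qed

lemma double_category_double_pseudo_slice: "double_category (double_pseudo_slice A I)"
  apply (intro double_category.intro)
  apply (simp_all only: dslice_sel category_dslice_ver category_dslice_hpaste category_dslice_vpaste)
  subgoal using category_dslice_hor by (simp add: double_pseudo_slice_def)
  subgoal by (elim dslice_sqrE; simp add: dslice_vdom_def)
  subgoal by (elim dslice_sqrE; simp add: dslice_vdom_def)
  subgoal by (elim dslice_sqrE; simp add: dslice_vcod_def)
  subgoal by (elim dslice_sqrE; simp add: dslice_vcod_def)
  subgoal by (elim dslice_verE; simp)
  subgoal by (elim dslice_verE; simp)
  subgoal by (elim dslice_horE; simp)
  subgoal by (elim dslice_horE; simp)
  subgoal by (elim dslice_sqrE; simp)
  subgoal by (elim dslice_sqrE; simp)
  subgoal by (elim dslice_sqrE; simp)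
  subgoal by (elim dslice_sqrE; simp)
  subgoal by (auto simp: dslice_objs_def dslice_vdom_def dslice_vcod_def dc_simps)
  subgoal by (elim dslice_verE; simp add: dslice_vdom_def dslice_vcod_def dc_simps)
  subgoal by (elim dslice_horE; simp add: dc_simps)
  subgoal by (elim dslice_sqrE2) (simp add: sq_interchange)
  done

lemma double_functor_double_pseudo_slice:
  "double_functor (double_pseudo_slice A I) A
       (\<lambda>(X, _). X) (\<lambda>(_, (a, _), _). a) (\<lambda>(u, _). u) (\<lambda>(_, _, _, _, \<alpha>). \<alpha>)"
  unfolding double_functor_def dslice_sel
  apply (intro conjI ballI impI double_category_double_pseudo_slice double_category_axioms)
  apply ((clarsimp simp: dslice_objs_def; fail) | (elim dslice_horE dslice_verE dslice_sqrE; simp; fail))+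
  done

end
end

theory Submission
  imports Defs
begin

text \<open>
  Bi-initiality of \<open>I\<close> in a 2-category only concerns cells of the following kind. For morphisms
  \<open>f, f'\<close> out of \<open>I\<close> and a morphism \<open>a\<close> between their targets, a comparison is an invertible
  2-morphism \<open>f' \<Rightarrow> a f\<close>, that is, the second component of a morphism of the pseudo-slice. Bi-initiality
  says that every object receives a morphism from \<open>I\<close>, that all comparisons exist, and that they are
  natural in \<open>a\<close>; naturality at an identity 2-morphism makes them unique. Double bi-initiality
  asks for morphisms from \<open>I\<close> and comparisons in \<open>\<^bold>H\<close> in the same way; moreover every vertical morphism \<open>u\<close> must
  be the right boundary of a square whose left boundary is \<open>e\<^sub>I\<close>, and the comparisons must be natural
  with respect to all squares of the double category (lemmas \<open>bi_initial_iff\<close> and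
  \<open>double_bi_initial_iff\<close>).

  The equivalence then rests on one observation (lemma \<open>comparison_V_iff\<close>): a comparison
  \<open>\<gamma>' \<Rightarrow> \<gamma> \<parallel> \<alpha>\<close> in \<open>V\<close> is a pair of comparisons in \<open>\<^bold>H\<close>, one for the tops and one for the bottoms,
  subject to exactly the equation that expresses their naturality with respect to the square \<open>\<alpha>\<close>.

  If \<open>I\<close> is double bi-initial, the comparisons in \<open>\<^bold>H\<close> for tops and bottoms exist, and by naturality
  they form a comparison in \<open>V\<close>. The 2-morphisms of \<open>V\<close> are pairs of squares with vertical identities on
  the sides, so naturality in \<open>V\<close> is naturality in the double category for each of the two squares.

  If conversely \<open>e\<^sub>I\<close> is bi-initial in \<open>V\<close>, then \<open>I\<close> is bi-initial in \<open>\<^bold>H\<close>, because vertical identity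
  squares embed \<open>\<^bold>H\<close> into \<open>V\<close>. For a square \<open>\<alpha>\<close>, bi-initiality in \<open>V\<close> produces some pair of
  comparisons in \<open>\<^bold>H\<close> that is natural with respect to \<open>\<alpha>\<close>; as comparisons in \<open>\<^bold>H\<close> are unique, every
  given pair is this one, so \<open>I\<close> is double bi-initial.
\<close>

section \<open>Bi-initiality through comparison cells\<close>

definition comparison :: "('o, 'm, 'c) two_cat \<Rightarrow> 'm \<Rightarrow> 'm \<Rightarrow> 'm \<Rightarrow> 'c \<Rightarrow> bool" where
  "comparison X f f' a \<psi> \<longleftrightarrow> cell_invertible X \<psi> \<and> csrc X \<psi> = f' \<and> ctgt X \<psi> = a \<odot>\<^bsub>X\<^esub> f"

context two_category
begin

text \<open>
  The three conditions are surjectivity on objects, fullness on morphisms and fullness on 2-morphisms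
  of the projection. A lift of a 2-morphism is automatically unique, as a 2-morphism of the
  pseudo-slice is a 2-morphism of the 2-category together with its source and target.
\<close>

lemma bi_initial_iff:
  "bi_initial X I \<longleftrightarrow> I \<in> Ob X \<and>
     (\<forall>y\<in>Ob X. \<exists>f\<in>Mor X. src X f = I \<and> tgt X f = y) \<and>
     (\<forall>f\<in>Mor X. \<forall>f'\<in>Mor X. \<forall>a\<in>Mor X.
        src X f = I \<and> src X f' = I \<and> src X a = tgt X f \<and> tgt X a = tgt X f' \<longrightarrow>
        (\<exists>\<psi>. comparison X f f' a \<psi>)) \<and>
     (\<forall>f\<in>Mor X. \<forall>f'\<in>Mor X. \<forall>\<beta>\<in>Cell X. \<forall>\<psi> \<phi>.
        src X f = I \<and> src X (csrc X \<beta>) = tgt X f \<and>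
        comparison X f f' (csrc X \<beta>) \<psi> \<and> comparison X f f' (ctgt X \<beta>) \<phi> \<longrightarrow>
        (\<beta> \<star> id2 X f) \<circ>\<circ> \<psi> = \<phi>)"
    (is "_ \<longleftrightarrow> _ \<and> ?obj \<and> ?mor \<and> ?cell")
proof (cases "I \<in> Ob X")
  case True
  let ?S = "pseudo_slice X I"
  have "(\<forall>y\<in>Ob X. \<exists>x\<in>Ob ?S. (case x of (A, _) \<Rightarrow> A) = y) \<longleftrightarrow> ?obj"
    by (auto simp: slice_objs_def) blast
  moreover have "(\<forall>x\<in>Ob ?S. \<forall>x'\<in>Ob ?S. \<forall>k\<in>Mor X.
       src X k = (case x of (A, _) \<Rightarrow> A) \<and> tgt X k = (case x' of (A, _) \<Rightarrow> A) \<longrightarrow>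
       (\<exists>m\<in>Mor ?S. src ?S m = x \<and> tgt ?S m = x' \<and> (\<lambda>(_, (a, _), _). a) m = k)) \<longleftrightarrow> ?mor"
    (is "?L \<longleftrightarrow> _")
  proof
    assume L: ?L
    show ?mor
    proof (intro ballI impI, elim conjE)
      fix f f' a
      assume f: "f \<in> Mor X" "f' \<in> Mor X" "a \<in> Mor X" "src X f = I" "src X f' = I"
        and a: "src X a = tgt X f" "tgt X a = tgt X f'"
      have "(tgt X f, f) \<in> Ob ?S" "(tgt X f', f') \<in> Ob ?S"
        using f by (simp_all add: slice_objs_def tc_simps)
      with L f(3) a obtain m where m: "m \<in> slice_mors X I" "src ?S m = (tgt X f, f)"
        "tgt ?S m = (tgt X f', f')" "(\<lambda>(_, (a, _), _). a) m = a"
        by fastforce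
      from m(1) show "\<exists>\<psi>. comparison X f f' a \<psi>"
        by (rule slice_morE) (use m in \<open>auto simp: comparison_def\<close>)
    qed
  next
    assume M: ?mor
    show ?L
    proof (intro ballI impI, elim conjE)
      fix x x' k
      assume x: "x \<in> Ob ?S" "x' \<in> Ob ?S" and k: "k \<in> Mor X"
        "src X k = (case x of (A, _) \<Rightarrow> A)" "tgt X k = (case x' of (A, _) \<Rightarrow> A)"
      obtain f f' where f: "x = (tgt X f, f)" "x' = (tgt X f', f')"
        "f \<in> Mor X" "src X f = I" "f' \<in> Mor X" "src X f' = I"
        using x by (auto simp: slice_objs_def)
      have "\<exists>\<psi>. comparison X f f' k \<psi>"
        by (rule M[rule_format]) (use f k in simp_all)
      then obtain \<psi> where "comparison X f f' k \<psi>" by blast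
      with f k have "(x, (k, \<psi>), x') \<in> slice_mors X I"
        by (auto simp: comparison_def intro!: slice_morI)
      then show "\<exists>m\<in>Mor ?S. src ?S m = x \<and> tgt ?S m = x' \<and> (\<lambda>(_, (a, _), _). a) m = k"
        by (intro bexI[of _ "(x, (k, \<psi>), x')"]) auto
    qed
  qed
  moreover have "(\<forall>m\<in>Mor ?S. \<forall>n\<in>Mor ?S. \<forall>\<beta>\<in>Cell X.
       src ?S m = src ?S n \<and> tgt ?S m = tgt ?S n \<and>
       csrc X \<beta> = (\<lambda>(_, (a, _), _). a) m \<and> ctgt X \<beta> = (\<lambda>(_, (a, _), _). a) n \<longrightarrow>
       (\<exists>!c. c \<in> Cell ?S \<and> csrc ?S c = m \<and> ctgt ?S c = n \<and> (case c of (_, \<beta>, _) \<Rightarrow> \<beta>) = \<beta>))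
     \<longleftrightarrow> ?cell" (is "?L \<longleftrightarrow> _")
  proof
    assume L: ?L
    show ?cell
    proof (intro ballI allI impI, elim conjE)
      fix f f' \<beta> \<psi> \<phi>
      assume f: "f \<in> Mor X" "f' \<in> Mor X" "\<beta> \<in> Cell X" "src X f = I" "src X (csrc X \<beta>) = tgt X f"
        and c: "comparison X f f' (csrc X \<beta>) \<psi>" "comparison X f f' (ctgt X \<beta>) \<phi>"
      let ?m = "((tgt X f, f), (csrc X \<beta>, \<psi>), (tgt X f', f'))"
      let ?n = "((tgt X f, f), (ctgt X \<beta>, \<phi>), (tgt X f', f'))"
      have p: "\<psi> \<in> Cell X" "csrc X \<psi> = f'" "ctgt X \<psi> = csrc X \<beta> \<odot> f"
        using c by (simp_all add: comparison_def cell_invertible_def)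
      have f': "src X f' = I" "tgt X f' = tgt X (csrc X \<beta>)"
        using f p src_glob[of \<psi>] tgt_glob[of \<psi>] by (simp_all add: tc_simps)
      have "?m \<in> slice_mors X I" "?n \<in> slice_mors X I"
        using f f' c by (auto simp: comparison_def tc_simps intro!: slice_morI)
      then obtain s where s: "s \<in> slice_cells X I" "csrc ?S s = ?m" "ctgt ?S s = ?n"
        "(case s of (_, \<beta>, _) \<Rightarrow> \<beta>) = \<beta>"
        using L[unfolded slice_sel, rule_format, of ?m ?n \<beta>] f(3) by auto
      from s(1) show "(\<beta> \<star> id2 X f) \<circ>\<circ> \<psi> = \<phi>"
        by (rule slice_cellE) (use s in auto)
    qed
  next
    assume C: ?cell
    show ?L
    proof (intro ballI impI, elim conjE)
      fix m n \<beta>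
      assume m: "m \<in> Mor ?S" "n \<in> Mor ?S" and b: "\<beta> \<in> Cell X"
        and e: "src ?S m = src ?S n" "tgt ?S m = tgt ?S n"
        and be: "csrc X \<beta> = (\<lambda>(_, (a, _), _). a) m" "ctgt X \<beta> = (\<lambda>(_, (a, _), _). a) n"
      have "(m, \<beta>, n) \<in> slice_cells X I"
        using m(1)[unfolded slice_sel]
      proof (cases rule: slice_morE)
        case m': (1 x x' a f f' \<psi>)
        show ?thesis using m(2)[unfolded slice_sel]
        proof (cases rule: slice_morE)
          case n': (1 y y' a' g g' \<phi>)
          have e': "y = x" "y' = x'" "g = f" "g' = f'" using e m'(1) n'(1) by simp_all
          have "(\<beta> \<star> id2 X f) \<circ>\<circ> \<psi> = \<phi>"
            using C b be m' n'[unfolded e'] by (auto simp: comparison_def)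
          then show ?thesis using m b be unfolding m'(1) n'(1)[unfolded e']
            by (auto intro!: slice_cellI)
        qed
      qed
      then show "\<exists>!c. c \<in> Cell ?S \<and> csrc ?S c = m \<and> ctgt ?S c = n \<and> (case c of (_, \<beta>, _) \<Rightarrow> \<beta>) = \<beta>"
        by (intro ex1I[of _ "(m, \<beta>, n)"]) auto
    qed
  qed
  ultimately show ?thesis
    using True two_functor_pseudo_slice[of I]
    unfolding bi_initial_def trivial_fibration_def by (simp only: simp_thms)
qed (simp add: bi_initial_def)

lemma bi_initial_existsE:
  assumes "bi_initial X I" "y \<in> Ob X"
  obtains f where "f \<in> Mor X" "src X f = I" "tgt X f = y"
  using assms unfolding bi_initial_iff by blast

lemma bi_initial_comparisonE:
  assumes "bi_initial X I" "f \<in> Mor X" "f' \<in> Mor X" "a \<in> Mor X"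
    and "src X f = I" "src X f' = I" "src X a = tgt X f" "tgt X a = tgt X f'"
  obtains \<psi> where "comparison X f f' a \<psi>"
  using assms unfolding bi_initial_iff by blast

lemma bi_initial_comparison_natural:
  assumes "bi_initial X I" "f \<in> Mor X" "f' \<in> Mor X" "\<beta> \<in> Cell X"
    and "src X f = I" "src X (csrc X \<beta>) = tgt X f"
    and "comparison X f f' (csrc X \<beta>) \<psi>" "comparison X f f' (ctgt X \<beta>) \<phi>"
  shows "(\<beta> \<star> id2 X f) \<circ>\<circ> \<psi> = \<phi>"
  using assms unfolding bi_initial_iff by blast

text \<open>
  Naturality at the identity 2-morphism of \<open>a\<close>, for the two given comparisons, reads \<open>\<psi> = \<phi>\<close>.
\<close>

lemma bi_initial_comparison_unique:
  assumes "bi_initial X I" "f \<in> Mor X" "a \<in> Mor X" "src X f = I" "src X a = tgt X f"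
    and "comparison X f f' a \<psi>" "comparison X f f' a \<phi>"
  shows "\<psi> = \<phi>"
proof -
  have p: "\<psi> \<in> Cell X" "csrc X \<psi> = f'" "ctgt X \<psi> = a \<odot> f"
    using assms(6) by (simp_all add: comparison_def cell_invertible_def)
  then have "f' \<in> Mor X" by (auto simp: tc_simps)
  then have "(id2 X a \<star> id2 X f) \<circ>\<circ> \<psi> = \<phi>"
    using assms by (intro bi_initial_comparison_natural[where I = I]) (simp_all add: tc_simps)
  moreover have "(id2 X a \<star> id2 X f) \<circ>\<circ> \<psi> = \<psi>"
    using p assms(2,3,5) by (simp add: tc_simps')
  ultimately show ?thesis by simp
qed

end

section \<open>Comparisons in \<open>V\<close> as pairs of comparisons in \<open>\<^bold>H\<close>\<close>

context double_category
begin

interpretation H: two_category "H_two_cat A" by (rule two_category_H)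
interpretation V: two_category "V_two_cat A" by (rule two_category_V)

lemma vert_invertible_globular:
  assumes "vert_invertible A \<sigma>"
  shows "\<sigma> \<in> Sqr A" "sqleft A \<sigma> = vid A (hdom A (sqtop A \<sigma>))"
    "sqright A \<sigma> = vid A (hcod A (sqtop A \<sigma>))"
  using assms by (simp_all add: vert_invertible_def)

text \<open>
  The inverses of \<open>\<sigma>\<^sub>0\<close> and \<open>\<sigma>\<^sub>1\<close> automatically form a 2-morphism of \<open>V\<close>: pasting the inverse of \<open>\<sigma>\<^sub>0\<close>
  above and the inverse of \<open>\<sigma>\<^sub>1\<close> below turns \<open>\<sigma>\<^sub>0 \<sslash> \<alpha>' = \<alpha> \<sslash> \<sigma>\<^sub>1\<close> into the equation for the inverse pair.
\<close>

lemma cell_invertible_V_iff: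
  "cell_invertible (V_two_cat A) (\<alpha>, (\<sigma>\<^sub>0, \<sigma>\<^sub>1), \<alpha>') \<longleftrightarrow>
     (\<alpha>, (\<sigma>\<^sub>0, \<sigma>\<^sub>1), \<alpha>') \<in> V_cells A \<and> vert_invertible A \<sigma>\<^sub>0 \<and> vert_invertible A \<sigma>\<^sub>1"
proof (intro iffI conjI; (elim conjE)?)
  assume "cell_invertible (V_two_cat A) (\<alpha>, (\<sigma>\<^sub>0, \<sigma>\<^sub>1), \<alpha>')"
  then obtain t where s: "(\<alpha>, (\<sigma>\<^sub>0, \<sigma>\<^sub>1), \<alpha>') \<in> V_cells A" and t: "t \<in> V_cells A"
    "csrc (V_two_cat A) t = \<alpha>'" "ctgt (V_two_cat A) t = \<alpha>"
    "t \<circ>\<circ>\<^bsub>V_two_cat A\<^esub> (\<alpha>, (\<sigma>\<^sub>0, \<sigma>\<^sub>1), \<alpha>') = id2 (V_two_cat A) \<alpha>"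
    "(\<alpha>, (\<sigma>\<^sub>0, \<sigma>\<^sub>1), \<alpha>') \<circ>\<circ>\<^bsub>V_two_cat A\<^esub> t = id2 (V_two_cat A) \<alpha>'"
    unfolding cell_invertible_def by auto
  obtain \<tau>\<^sub>0 \<tau>\<^sub>1 where te: "t = (\<alpha>', (\<tau>\<^sub>0, \<tau>\<^sub>1), \<alpha>)"
    using t(2,3) by (cases t) auto
  show "(\<alpha>, (\<sigma>\<^sub>0, \<sigma>\<^sub>1), \<alpha>') \<in> V_cells A" by (fact s)
  note k = s[unfolded V_cells_def, simplified] t(1)[unfolded te V_cells_def, simplified]
    t(4,5)[unfolded te, simplified]
  have "hdom A (sqtop A \<alpha>') = hdom A (sqtop A \<alpha>)" "hcod A (sqtop A \<alpha>') = hcod A (sqtop A \<alpha>)"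
    "hdom A (sqbot A \<alpha>') = hdom A (sqbot A \<alpha>)" "hcod A (sqbot A \<alpha>') = hcod A (sqbot A \<alpha>)"
    using k by (simp_all add: corner_top_left corner_top_right corner_bot_left corner_bot_right)
  note k = this k
  show "vert_invertible A \<sigma>\<^sub>0"
    unfolding vert_invertible_def by (intro conjI bexI[of _ \<tau>\<^sub>0]) (simp_all add: k)
  show "vert_invertible A \<sigma>\<^sub>1"
    unfolding vert_invertible_def by (intro conjI bexI[of _ \<tau>\<^sub>1]) (simp_all add: k)
next
  assume s: "(\<alpha>, (\<sigma>\<^sub>0, \<sigma>\<^sub>1), \<alpha>') \<in> V_cells A"
    and "vert_invertible A \<sigma>\<^sub>0" "vert_invertible A \<sigma>\<^sub>1"
  then obtain \<tau>\<^sub>0 \<tau>\<^sub>1 where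
    t0: "\<tau>\<^sub>0 \<in> Sqr A" "sqtop A \<tau>\<^sub>0 = sqbot A \<sigma>\<^sub>0" "sqbot A \<tau>\<^sub>0 = sqtop A \<sigma>\<^sub>0"
      "sqleft A \<tau>\<^sub>0 = sqleft A \<sigma>\<^sub>0" "sqright A \<tau>\<^sub>0 = sqright A \<sigma>\<^sub>0"
      "\<sigma>\<^sub>0 \<sslash> \<tau>\<^sub>0 = vidsq A (sqtop A \<sigma>\<^sub>0)" "\<tau>\<^sub>0 \<sslash> \<sigma>\<^sub>0 = vidsq A (sqbot A \<sigma>\<^sub>0)"
    and t1: "\<tau>\<^sub>1 \<in> Sqr A" "sqtop A \<tau>\<^sub>1 = sqbot A \<sigma>\<^sub>1" "sqbot A \<tau>\<^sub>1 = sqtop A \<sigma>\<^sub>1"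
      "sqleft A \<tau>\<^sub>1 = sqleft A \<sigma>\<^sub>1" "sqright A \<tau>\<^sub>1 = sqright A \<sigma>\<^sub>1"
      "\<sigma>\<^sub>1 \<sslash> \<tau>\<^sub>1 = vidsq A (sqtop A \<sigma>\<^sub>1)" "\<tau>\<^sub>1 \<sslash> \<sigma>\<^sub>1 = vidsq A (sqbot A \<sigma>\<^sub>1)"
    unfolding vert_invertible_def by blast
  note k = s[unfolded V_cells_def, simplified]
  have sq: "\<alpha> \<in> Sqr A" "\<alpha>' \<in> Sqr A" "\<sigma>\<^sub>0 \<in> Sqr A" "\<sigma>\<^sub>1 \<in> Sqr A" "sqtop A \<sigma>\<^sub>0 = sqtop A \<alpha>"
    "sqbot A \<sigma>\<^sub>0 = sqtop A \<alpha>'" "sqtop A \<sigma>\<^sub>1 = sqbot A \<alpha>" "sqbot A \<sigma>\<^sub>1 = sqbot A \<alpha>'"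
    using k by simp_all
  have "\<tau>\<^sub>0 \<sslash> \<alpha> = \<tau>\<^sub>0 \<sslash> (\<alpha> \<sslash> (\<sigma>\<^sub>1 \<sslash> \<tau>\<^sub>1))"
    using k t0(1-5) t1 by (simp add: dc_simps)
  also have "\<dots> = \<tau>\<^sub>0 \<sslash> ((\<alpha> \<sslash> \<sigma>\<^sub>1) \<sslash> \<tau>\<^sub>1)"
    using k t1(1-5) by (simp add: vp.comp_assoc)
  also have "\<dots> = \<tau>\<^sub>0 \<sslash> ((\<sigma>\<^sub>0 \<sslash> \<alpha>') \<sslash> \<tau>\<^sub>1)"
    using k by simp
  also have "\<dots> = (\<tau>\<^sub>0 \<sslash> \<sigma>\<^sub>0) \<sslash> (\<alpha>' \<sslash> \<tau>\<^sub>1)"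
    using sq t0(1-3) t1(1-3) by (simp add: vp.comp_assoc vp.cat_simps)
  also have "\<dots> = \<alpha>' \<sslash> \<tau>\<^sub>1"
    using k t0 t1(1-5) by (simp add: dc_simps)
  finally have "\<tau>\<^sub>0 \<sslash> \<alpha> = \<alpha>' \<sslash> \<tau>\<^sub>1" .
  then have "(\<alpha>', (\<tau>\<^sub>0, \<tau>\<^sub>1), \<alpha>) \<in> V_cells A"
    using k t0(1-5) t1(1-5) by (intro V_cellI) (simp_all add: dc_simps)
  then show "cell_invertible (V_two_cat A) (\<alpha>, (\<sigma>\<^sub>0, \<sigma>\<^sub>1), \<alpha>')"
    unfolding cell_invertible_def using s k t0 t1
    by (intro conjI bexI[of _ "(\<alpha>', (\<tau>\<^sub>0, \<tau>\<^sub>1), \<alpha>)"]) simp_all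
qed

text \<open>
  This is the bridge between \<open>V\<close> and the double category: when \<open>\<gamma>\<close> and \<open>\<gamma>'\<close> have
  the vertical identity at \<open>I\<close> as left boundary, the last equation is the condition for \<open>\<alpha>\<close>
  to be a square of the pseudo-slice double category with top \<open>\<psi>\<^sub>0\<close>, bottom \<open>\<psi>\<^sub>1\<close>, left \<open>\<gamma>\<close> and right \<open>\<gamma>'\<close>.
\<close>

lemma comparison_V_iff:
  assumes "\<gamma> \<in> Sqr A" "\<gamma>' \<in> Sqr A" "\<alpha> \<in> Sqr A"
    and "sqleft A \<gamma>' = sqleft A \<gamma>" "sqleft A \<alpha> = sqright A \<gamma>" "sqright A \<alpha> = sqright A \<gamma>'"
  shows "comparison (V_two_cat A) \<gamma> \<gamma>' \<alpha> s \<longleftrightarrow>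
    (\<exists>\<psi>\<^sub>0 \<psi>\<^sub>1. s = (\<gamma>', (\<psi>\<^sub>0, \<psi>\<^sub>1), \<gamma> \<parallel> \<alpha>) \<and>
       comparison (H_two_cat A) (sqtop A \<gamma>) (sqtop A \<gamma>') (sqtop A \<alpha>) \<psi>\<^sub>0 \<and>
       comparison (H_two_cat A) (sqbot A \<gamma>) (sqbot A \<gamma>') (sqbot A \<alpha>) \<psi>\<^sub>1 \<and>
       \<psi>\<^sub>0 \<sslash> (\<gamma> \<parallel> \<alpha>) = \<gamma>' \<sslash> \<psi>\<^sub>1)"
proof -
  obtain \<delta> \<psi>\<^sub>0 \<psi>\<^sub>1 \<delta>' where s: "s = (\<delta>, (\<psi>\<^sub>0, \<psi>\<^sub>1), \<delta>')" by (metis prod.exhaust)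
  have "(\<gamma>', (\<psi>\<^sub>0, \<psi>\<^sub>1), \<gamma> \<parallel> \<alpha>) \<in> V_cells A \<and> vert_invertible A \<psi>\<^sub>0 \<and> vert_invertible A \<psi>\<^sub>1 \<longleftrightarrow>
       (vert_invertible A \<psi>\<^sub>0 \<and> sqtop A \<psi>\<^sub>0 = sqtop A \<gamma>' \<and> sqbot A \<psi>\<^sub>0 = sqtop A \<alpha> \<cdot> sqtop A \<gamma>) \<and>
       (vert_invertible A \<psi>\<^sub>1 \<and> sqtop A \<psi>\<^sub>1 = sqbot A \<gamma>' \<and> sqbot A \<psi>\<^sub>1 = sqbot A \<alpha> \<cdot> sqbot A \<gamma>) \<and>
       \<psi>\<^sub>0 \<sslash> (\<gamma> \<parallel> \<alpha>) = \<gamma>' \<sslash> \<psi>\<^sub>1"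
    using assms vert_invertible_globular[of \<psi>\<^sub>0] vert_invertible_globular[of \<psi>\<^sub>1]
    by (auto simp: V_cells_def sqtop_hpaste sqbot_hpaste hp.comp_closed hp.src_comp hp.tgt_comp)
  then show ?thesis
    unfolding s comparison_def vert_invertible_iff[symmetric] H_sel
    by (auto simp: cell_invertible_V_iff)
qed

text \<open>
  A comparison in \<open>\<^bold>H\<close> has vertical identities on its sides, so its top and bottom are parallel. The
  boundary of \<open>f'\<close> and the sides of \<open>\<psi>\<close> are therefore determined by \<open>f\<close> and \<open>a\<close>.
\<close>

lemma comparison_HE:
  assumes "comparison (H_two_cat A) f f' a \<psi>" "f \<in> Hor A" "a \<in> Hor A" "hcod A f = hdom A a"
  shows "\<psi> \<in> Sqr A" "sqtop A \<psi> = f'" "sqbot A \<psi> = a \<cdot> f" "f' \<in> Hor A"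
    "hdom A f' = hdom A f" "hcod A f' = hcod A a"
    "sqleft A \<psi> = vid A (hdom A f)" "sqright A \<psi> = vid A (hcod A a)"
proof -
  have p: "vert_invertible A \<psi>" "sqtop A \<psi> = f'" "sqbot A \<psi> = a \<cdot> f"
    using assms(1) by (simp_all add: comparison_def vert_invertible_iff)
  note g = vert_invertible_globular[OF p(1)]
  have "hdom A f' = hdom A (sqbot A \<psi>)" "hcod A f' = hcod A (sqbot A \<psi>)" "f' \<in> Hor A"
    using g p(2) vp.src_closed[of \<psi>] hor.src_closed hor.tgt_closed
    by (auto simp: corner_bot_left corner_bot_right ver.tgt_ident)
  with p g assms(2-4) show "\<psi> \<in> Sqr A" "sqtop A \<psi> = f'" "sqbot A \<psi> = a \<cdot> f" "f' \<in> Hor A"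
    "hdom A f' = hdom A f" "hcod A f' = hcod A a"
    "sqleft A \<psi> = vid A (hdom A f)" "sqright A \<psi> = vid A (hcod A a)"
    by (simp_all add: dc_simps)
qed

section \<open>Double bi-initiality through comparison squares\<close>

lemma dslice_horI:
  assumes "f \<in> Hor A" "a \<in> Hor A" "hdom A f = I" "hcod A f = hdom A a"
    and "comparison (H_two_cat A) f f' a \<psi>"
  shows "((hdom A a, f), (a, \<psi>), (hcod A a, f')) \<in> dslice_hors A I"
  using assms comparison_HE[OF assms(5,1,2,4)]
  by (simp add: dslice_hors_def dslice_objs_def comparison_def vert_invertible_iff dc_simps)

lemma dslice_horD:
  assumes "((x, f), (a, \<psi>), (x', f')) \<in> dslice_hors A I"
  shows "comparison (H_two_cat A) f f' a \<psi>"
  using assms by (simp add: dslice_hors_def comparison_def vert_invertible_iff)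

text \<open>
  As in the 2-categorical case, a square of the pseudo-slice is a square of the double category together
  with its boundary, so its lifts are unique, and full faithfulness on squares becomes naturality of the
  comparisons with respect to squares.
\<close>

lemma double_bi_initial_iff:
  "double_bi_initial A I \<longleftrightarrow> I \<in> Obj A \<and>
     (\<forall>x\<in>Obj A. \<exists>f\<in>Hor A. hdom A f = I \<and> hcod A f = x) \<and>
     (\<forall>f\<in>Hor A. \<forall>f'\<in>Hor A. \<forall>a\<in>Hor A.
        hdom A f = I \<and> hdom A f' = I \<and> hdom A a = hcod A f \<and> hcod A a = hcod A f' \<longrightarrow>
        (\<exists>\<psi>. comparison (H_two_cat A) f f' a \<psi>)) \<and>
     (\<forall>u\<in>Ver A. \<exists>\<gamma>\<in>Sqr A. sqleft A \<gamma> = vid A I \<and> sqright A \<gamma> = u) \<and>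
     (\<forall>\<gamma>\<in>Sqr A. \<forall>\<gamma>'\<in>Sqr A. \<forall>\<alpha>\<in>Sqr A. \<forall>\<psi> \<phi>.
        sqleft A \<gamma> = vid A I \<and> sqleft A \<gamma>' = vid A I \<and>
        sqleft A \<alpha> = sqright A \<gamma> \<and> sqright A \<alpha> = sqright A \<gamma>' \<and>
        comparison (H_two_cat A) (sqtop A \<gamma>) (sqtop A \<gamma>') (sqtop A \<alpha>) \<psi> \<and>
        comparison (H_two_cat A) (sqbot A \<gamma>) (sqbot A \<gamma>') (sqbot A \<alpha>) \<phi> \<longrightarrow>
        \<psi> \<sslash> (\<gamma> \<parallel> \<alpha>) = \<gamma>' \<sslash> \<phi>)"
    (is "_ \<longleftrightarrow> _ \<and> ?obj \<and> ?hor \<and> ?ver \<and> ?sqr")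
proof (cases "I \<in> Obj A")
  case True
  let ?S = "double_pseudo_slice A I"
  have "(\<forall>y\<in>Obj A. \<exists>x\<in>Obj ?S. (case x of (X, _) \<Rightarrow> X) = y) \<longleftrightarrow> ?obj"
    by (auto simp: dslice_objs_def) blast
  moreover have "(\<forall>x\<in>Obj ?S. \<forall>x'\<in>Obj ?S. \<forall>k\<in>Hor A.
       hdom A k = (case x of (X, _) \<Rightarrow> X) \<and> hcod A k = (case x' of (X, _) \<Rightarrow> X) \<longrightarrow>
       (\<exists>m\<in>Hor ?S. hdom ?S m = x \<and> hcod ?S m = x' \<and> (\<lambda>(_, (a, _), _). a) m = k)) \<longleftrightarrow> ?hor"
    (is "?L \<longleftrightarrow> _")
  proof
    assume L: ?L
    show ?hor
    proof (intro ballI impI, elim conjE)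
      fix f f' a
      assume f: "f \<in> Hor A" "f' \<in> Hor A" "a \<in> Hor A" "hdom A f = I" "hdom A f' = I"
        and a: "hdom A a = hcod A f" "hcod A a = hcod A f'"
      have "(hcod A f, f) \<in> Obj ?S" "(hcod A f', f') \<in> Obj ?S"
        using f by (simp_all add: dslice_objs_def dc_simps)
      with L f(3) a obtain m where m: "m \<in> dslice_hors A I" "hdom ?S m = (hcod A f, f)"
        "hcod ?S m = (hcod A f', f')" "(\<lambda>(_, (a, _), _). a) m = a"
        by fastforce
      then obtain \<psi> where "m = ((hcod A f, f), (a, \<psi>), (hcod A f', f'))"
        by (cases m) auto
      with m(1) show "\<exists>\<psi>. comparison (H_two_cat A) f f' a \<psi>" by (auto dest: dslice_horD)
    qed
  next
    assume M: ?hor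
    show ?L
    proof (intro ballI impI, elim conjE)
      fix x x' k
      assume x: "x \<in> Obj ?S" "x' \<in> Obj ?S" and k: "k \<in> Hor A"
        "hdom A k = (case x of (X, _) \<Rightarrow> X)" "hcod A k = (case x' of (X, _) \<Rightarrow> X)"
      obtain f f' where f: "x = (hcod A f, f)" "x' = (hcod A f', f')"
        "f \<in> Hor A" "hdom A f = I" "f' \<in> Hor A" "hdom A f' = I"
        using x by (auto simp: dslice_objs_def)
      have "\<exists>\<psi>. comparison (H_two_cat A) f f' k \<psi>"
        by (rule M[rule_format]) (use f k in simp_all)
      then obtain \<psi> where "comparison (H_two_cat A) f f' k \<psi>" by blast
      with f k have "(x, (k, \<psi>), x') \<in> dslice_hors A I"
        using dslice_horI[of f k I f' \<psi>] by simp
      then show "\<exists>m\<in>Hor ?S. hdom ?S m = x \<and> hcod ?S m = x' \<and> (\<lambda>(_, (a, _), _). a) m = k"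
        by (intro bexI[of _ "(x, (k, \<psi>), x')"]) auto
    qed
  qed
  moreover have "(\<forall>w\<in>Ver A. \<exists>l\<in>Ver ?S. (case l of (u, _) \<Rightarrow> u) = w) \<longleftrightarrow> ?ver"
  proof -
    have "(\<exists>l\<in>dslice_vers A I. (case l of (u, _) \<Rightarrow> u) = w) \<longleftrightarrow>
        (\<exists>\<gamma>\<in>Sqr A. sqleft A \<gamma> = vid A I \<and> sqright A \<gamma> = w)" if "w \<in> Ver A" for w
      using that True dslice_verI[of w] by (fastforce simp: dslice_vers_def)
    then show ?thesis by simp
  qed
  moreover have "(\<forall>a\<in>Hor ?S. \<forall>b\<in>Hor ?S. \<forall>u\<in>Ver ?S. \<forall>v\<in>Ver ?S. \<forall>\<beta>\<in>Sqr A.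
       hdom ?S a = vdom ?S u \<and> hcod ?S a = vdom ?S v \<and>
       hdom ?S b = vcod ?S u \<and> hcod ?S b = vcod ?S v \<and>
       sqtop A \<beta> = (\<lambda>(_, (a, _), _). a) a \<and> sqbot A \<beta> = (\<lambda>(_, (a, _), _). a) b \<and>
       sqleft A \<beta> = (case u of (u, _) \<Rightarrow> u) \<and> sqright A \<beta> = (case v of (u, _) \<Rightarrow> u) \<longrightarrow>
       (\<exists>!s. s \<in> Sqr ?S \<and> sqtop ?S s = a \<and> sqbot ?S s = b \<and> sqleft ?S s = u \<and> sqright ?S s = v \<and>
          (case s of (_, _, _, _, \<alpha>) \<Rightarrow> \<alpha>) = \<beta>)) \<longleftrightarrow> ?sqr" (is "?L \<longleftrightarrow> _")
  proof
    assume L: ?L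
    show ?sqr
    proof (intro ballI allI impI, elim conjE)
      fix \<gamma> \<gamma>' \<alpha> \<psi> \<phi>
      assume s: "\<gamma> \<in> Sqr A" "\<gamma>' \<in> Sqr A" "\<alpha> \<in> Sqr A"
        and e: "sqleft A \<gamma> = vid A I" "sqleft A \<gamma>' = vid A I" "sqleft A \<alpha> = sqright A \<gamma>"
          "sqright A \<alpha> = sqright A \<gamma>'"
        and c: "comparison (H_two_cat A) (sqtop A \<gamma>) (sqtop A \<gamma>') (sqtop A \<alpha>) \<psi>"
          "comparison (H_two_cat A) (sqbot A \<gamma>) (sqbot A \<gamma>') (sqbot A \<alpha>) \<phi>"
      let ?t = "((hdom A (sqtop A \<alpha>), sqtop A \<gamma>), (sqtop A \<alpha>, \<psi>), (hcod A (sqtop A \<alpha>), sqtop A \<gamma>'))"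
      let ?b = "((hdom A (sqbot A \<alpha>), sqbot A \<gamma>), (sqbot A \<alpha>, \<phi>), (hcod A (sqbot A \<alpha>), sqbot A \<gamma>'))"
      let ?l = "(sqright A \<gamma>, \<gamma>)" and ?r = "(sqright A \<gamma>', \<gamma>')"
      have "?t \<in> dslice_hors A I" "?b \<in> dslice_hors A I"
        by (rule dslice_horI; use s e c True in \<open>simp add: dc_simps\<close>)+
      moreover have "?l \<in> dslice_vers A I" "?r \<in> dslice_vers A I"
        by (rule dslice_verI; use s e True in \<open>simp add: dc_simps\<close>)+
      ultimately have "\<exists>!s. s \<in> Sqr ?S \<and> sqtop ?S s = ?t \<and> sqbot ?S s = ?b \<and> sqleft ?S s = ?l \<and>
          sqright ?S s = ?r \<and> (case s of (_, _, _, _, \<alpha>) \<Rightarrow> \<alpha>) = \<alpha>"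
        using s e by (intro L[unfolded dslice_sel, rule_format, of ?t ?b ?l ?r \<alpha>, folded dslice_sel])
          (simp_all add: dslice_vdom_def dslice_vcod_def dc_simps)
      then have "(?t, ?b, ?l, ?r, \<alpha>) \<in> dslice_sqrs A I"
        by (auto simp: split_paired_all)
      then show "\<psi> \<sslash> (\<gamma> \<parallel> \<alpha>) = \<gamma>' \<sslash> \<phi>"
        by (simp add: dslice_sqrs_def)
    qed
  next
    assume C: ?sqr
    show ?L
    proof (intro ballI impI, elim conjE)
      fix t b l r \<beta>
      assume m: "t \<in> Hor ?S" "b \<in> Hor ?S" "l \<in> Ver ?S" "r \<in> Ver ?S" and \<beta>: "\<beta> \<in> Sqr A"
        and e: "hdom ?S t = vdom ?S l" "hcod ?S t = vdom ?S r" "hdom ?S b = vcod ?S l" "hcod ?S b = vcod ?S r"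
        and \<beta>e: "sqtop A \<beta> = (\<lambda>(_, (a, _), _). a) t" "sqbot A \<beta> = (\<lambda>(_, (a, _), _). a) b"
          "sqleft A \<beta> = (case l of (u, _) \<Rightarrow> u)" "sqright A \<beta> = (case r of (u, _) \<Rightarrow> u)"
      obtain x f a \<psi> x' f' y g b' \<phi> y' g' u \<gamma> u' \<gamma>' where
        q: "t = ((x, f), (a, \<psi>), (x', f'))" "b = ((y, g), (b', \<phi>), (y', g'))" "l = (u, \<gamma>)" "r = (u', \<gamma>')"
        by (metis prod.exhaust)
      have "\<psi> \<sslash> (\<gamma> \<parallel> \<beta>) = \<gamma>' \<sslash> \<phi>"
        using C m \<beta> e \<beta>e dslice_horD[of x f a \<psi> x' f' I] dslice_horD[of y g b' \<phi> y' g' I] unfolding q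
        by (auto simp: dslice_vdom_def dslice_vcod_def dslice_vers_def)
      then have "(t, b, l, r, \<beta>) \<in> dslice_sqrs A I"
        using m \<beta> e \<beta>e unfolding q by (auto intro!: dslice_sqrI)
      then show "\<exists>!s. s \<in> Sqr ?S \<and> sqtop ?S s = t \<and> sqbot ?S s = b \<and> sqleft ?S s = l \<and>
          sqright ?S s = r \<and> (case s of (_, _, _, _, \<alpha>) \<Rightarrow> \<alpha>) = \<beta>"
        by (intro ex1I[of _ "(t, b, l, r, \<beta>)"]) auto
    qed
  qed
  ultimately show ?thesis
    using True double_functor_double_pseudo_slice[of I]
    unfolding double_bi_initial_def double_trivial_fibration_def by (simp only: simp_thms)
qed (simp add: double_bi_initial_def)


section \<open>The implications between the three conditions\<close>

text \<open>
  Horizontal morphisms are viewed in \<open>V\<close> as their vertical identity squares, and a 2-morphism \<open>\<beta>\<close> of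
  \<open>\<^bold>H\<close> as the pair \<open>(\<beta>, \<beta>)\<close>. Under this embedding a comparison \<open>\<psi>\<close> of \<open>\<^bold>H\<close> becomes the comparison
  \<open>(\<psi>, \<psi>)\<close> of \<open>V\<close>, and the conditions for \<open>\<^bold>H\<close> are first components of those for \<open>V\<close>.
\<close>

lemma bi_initial_H_if_bi_initial_V:
  assumes V: "bi_initial (V_two_cat A) (vid A I)" and I: "I \<in> Obj A"
  shows "bi_initial (H_two_cat A) I"
  unfolding H.bi_initial_iff H_sel
proof (intro conjI ballI allI impI; (elim conjE)?)
  show "I \<in> Obj A" by (fact I)
next
  fix x assume x: "x \<in> Obj A"
  then have "vid A x \<in> Ob (V_two_cat A)" by (simp add: dc_simps)
  from V.bi_initial_existsE[OF V this] obtain \<gamma>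
    where "\<gamma> \<in> Sqr A" "sqleft A \<gamma> = vid A I" "sqright A \<gamma> = vid A x" by auto
  with x I show "\<exists>f\<in>Hor A. hdom A f = I \<and> hcod A f = x"
    by (intro bexI[of _ "sqtop A \<gamma>"]) (simp_all add: dc_simps)
next
  fix f f' a
  assume "f \<in> Hor A" "f' \<in> Hor A" "a \<in> Hor A" "hdom A f = I" "hdom A f' = I"
    "hdom A a = hcod A f" "hcod A a = hcod A f'"
  note f = this
  obtain s where "comparison (V_two_cat A) (vidsq A f) (vidsq A f') (vidsq A a) s"
    by (rule V.bi_initial_comparisonE[OF V, of "vidsq A f" "vidsq A f'" "vidsq A a"])
      (use f in \<open>simp_all add: dc_simps\<close>)
  then show "\<exists>\<psi>. comparison (H_two_cat A) f f' a \<psi>"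
    using f by (subst (asm) comparison_V_iff) (auto simp: dc_simps)
next
  fix f f' \<beta> \<psi> \<phi>
  assume f: "f \<in> Hor A" "f' \<in> Hor A" "\<beta> \<in> Cell (H_two_cat A)" "hdom A f = I" "hdom A (sqtop A \<beta>) = hcod A f"
    and c: "comparison (H_two_cat A) f f' (sqtop A \<beta>) \<psi>" "comparison (H_two_cat A) f f' (sqbot A \<beta>) \<phi>"
  have \<beta>: "\<beta> \<in> Sqr A" "sqleft A \<beta> = vid A (hcod A f)"
    using f by (simp_all add: H_two_cat_def)
  obtain y where y: "sqright A \<beta> = vid A y" "hcod A (sqtop A \<beta>) = y" "y \<in> Obj A"
    using f(3) \<beta>(1) by (auto simp: H_two_cat_def hor.tgt_closed vp.src_closed)
  have b: "hdom A (sqbot A \<beta>) = hcod A f" "hcod A (sqbot A \<beta>) = y"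
    using \<beta> f y by (simp_all add: corner_bot_left corner_bot_right hor.tgt_closed ver.tgt_ident)
  have ab: "sqtop A \<beta> \<in> Hor A" "sqbot A \<beta> \<in> Hor A"
    using \<beta> by (simp_all add: vp.cat_simps)
  note h = comparison_HE[OF c(1) f(1) ab(1) f(5)[symmetric]]
    and h' = comparison_HE[OF c(2) f(1) ab(2) b(1)[symmetric]]
  let ?V = "V_two_cat A"
  let ?\<gamma> = "vidsq A f" and ?\<gamma>' = "vidsq A f'"
  let ?\<alpha> = "vidsq A (sqtop A \<beta>)" and ?\<alpha>' = "vidsq A (sqbot A \<beta>)"
  have sq: "?\<gamma> \<in> Sqr A" "?\<gamma>' \<in> Sqr A" "?\<alpha> \<in> Sqr A" "?\<alpha>' \<in> Sqr A"
    "sqleft A ?\<gamma> = vid A I" "sqleft A ?\<gamma>' = vid A I" "sqright A ?\<gamma>' = vid A y"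
    "sqleft A ?\<alpha> = sqright A ?\<gamma>" "sqleft A ?\<alpha>' = sqright A ?\<gamma>"
    "sqright A ?\<alpha> = vid A y" "sqright A ?\<alpha>' = vid A y"
    using f(1,2,4,5) ab b y(2) h(5,6) by (simp_all add: vp.ident_closed sqleft_vidsq sqright_vidsq)
  have "\<psi> \<sslash> (?\<gamma> \<parallel> ?\<alpha>) = ?\<gamma>' \<sslash> \<psi>"
    using h(1-3) f(1,5) ab by (simp add: vidsq_hcomp[symmetric] vp.cat_simps)
  then have \<Psi>: "comparison ?V ?\<gamma> ?\<gamma>' ?\<alpha> (?\<gamma>', (\<psi>, \<psi>), ?\<gamma> \<parallel> ?\<alpha>)"
    using c(1) sq f(1,2) ab by (simp add: comparison_V_iff vp.src_ident vp.tgt_ident)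
  have "\<phi> \<sslash> (?\<gamma> \<parallel> ?\<alpha>') = ?\<gamma>' \<sslash> \<phi>"
    using h'(1-3) f(1) b ab by (simp add: vidsq_hcomp[symmetric] vp.cat_simps)
  then have \<Phi>: "comparison ?V ?\<gamma> ?\<gamma>' ?\<alpha>' (?\<gamma>', (\<phi>, \<phi>), ?\<gamma> \<parallel> ?\<alpha>')"
    using c(2) sq f(1,2) ab by (simp add: comparison_V_iff vp.src_ident vp.tgt_ident)
  have "(?\<alpha>, (\<beta>, \<beta>), ?\<alpha>') \<in> V_cells A"
    using \<beta> sq y f(1,5) b ab
    by (simp add: V_cells_def vp.src_ident vp.tgt_ident vp.comp_ident_left' vp.comp_ident_right')
  then have "((?\<alpha>, (\<beta>, \<beta>), ?\<alpha>') \<star>\<^bsub>?V\<^esub> id2 ?V ?\<gamma>) \<circ>\<circ>\<^bsub>?V\<^esub> (?\<gamma>', (\<psi>, \<psi>), ?\<gamma> \<parallel> ?\<alpha>)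
      = (?\<gamma>', (\<phi>, \<phi>), ?\<gamma> \<parallel> ?\<alpha>')"
    using sq \<Psi> \<Phi> by (intro V.bi_initial_comparison_natural[OF V, where f' = ?\<gamma>']) simp_all
  then show "\<psi> \<sslash> (vidsq A f \<parallel> \<beta>) = \<phi>"
    using f(1) by (simp add: vp.src_ident)
qed

text \<open>
  Naturality with respect to squares is used twice: for the square \<open>\<alpha>\<close> it makes a pair of comparisons in
  \<open>\<^bold>H\<close> into a comparison in \<open>V\<close>, and for the two components of a 2-morphism of \<open>V\<close> it gives naturality
  in \<open>V\<close>.
\<close>

lemma bi_initial_V_if_double_bi_initial:
  assumes D: "double_bi_initial A I"
  shows "bi_initial (V_two_cat A) (vid A I)"
proof -
  have I: "I \<in> Obj A"
    and mor: "\<And>f f' a. \<lbrakk>f \<in> Hor A; f' \<in> Hor A; a \<in> Hor A; hdom A f = I; hdom A f' = I;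
        hdom A a = hcod A f; hcod A a = hcod A f'\<rbrakk> \<Longrightarrow> \<exists>\<psi>. comparison (H_two_cat A) f f' a \<psi>"
    and ver: "\<And>u. u \<in> Ver A \<Longrightarrow> \<exists>\<gamma>\<in>Sqr A. sqleft A \<gamma> = vid A I \<and> sqright A \<gamma> = u"
    and sqr: "\<And>\<gamma> \<gamma>' \<alpha> \<psi> \<phi>. \<lbrakk>\<gamma> \<in> Sqr A; \<gamma>' \<in> Sqr A; \<alpha> \<in> Sqr A; sqleft A \<gamma> = vid A I;
        sqleft A \<gamma>' = vid A I; sqleft A \<alpha> = sqright A \<gamma>; sqright A \<alpha> = sqright A \<gamma>';
        comparison (H_two_cat A) (sqtop A \<gamma>) (sqtop A \<gamma>') (sqtop A \<alpha>) \<psi>;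
        comparison (H_two_cat A) (sqbot A \<gamma>) (sqbot A \<gamma>') (sqbot A \<alpha>) \<phi>\<rbrakk>
        \<Longrightarrow> \<psi> \<sslash> (\<gamma> \<parallel> \<alpha>) = \<gamma>' \<sslash> \<phi>"
    using D unfolding double_bi_initial_iff by blast+
  \<comment> \<open>The case of a square between vertical identities, with \<open>\<gamma>\<close> and \<open>\<gamma>'\<close> vertical identity squares.\<close>
  have natural: "\<psi> \<sslash> (vidsq A f \<parallel> \<sigma>) = \<phi>"
    if f: "f \<in> Hor A" "hdom A f = I" and \<sigma>: "\<sigma> \<in> Sqr A" "sqleft A \<sigma> = vid A (hcod A f)"
      "sqright A \<sigma> = vid A (hcod A (sqtop A \<sigma>))"
      and c: "comparison (H_two_cat A) f f' (sqtop A \<sigma>) \<psi>"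
        "comparison (H_two_cat A) f f' (sqbot A \<sigma>) \<phi>" for f f' \<sigma> \<psi> \<phi>
  proof -
    have t: "hdom A (sqtop A \<sigma>) = hcod A f"
      using f \<sigma> by (simp add: corner_top_left hor.tgt_closed ver.src_ident)
    note h = comparison_HE[OF c(1) f(1) vp.src_closed[OF \<sigma>(1)] t[symmetric]]
    have "hdom A (sqbot A \<sigma>) = hcod A f"
      using f \<sigma> by (simp add: corner_bot_left hor.tgt_closed ver.tgt_ident)
    note h' = comparison_HE[OF c(2) f(1) vp.tgt_closed[OF \<sigma>(1)] this[symmetric]]
    have "\<psi> \<sslash> (vidsq A f \<parallel> \<sigma>) = vidsq A f' \<sslash> \<phi>"
      by (rule sqr) (use f \<sigma> c h in \<open>simp_all add: vp.cat_simps sqleft_vidsq sqright_vidsq\<close>)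
    also have "\<dots> = \<phi>" using h' by (simp add: vp.cat_simps)
    finally show ?thesis .
  qed
  show ?thesis
    unfolding V.bi_initial_iff V_sel(1-5)
  proof (intro conjI ballI allI impI; (elim conjE)?)
    show "vid A I \<in> Ver A" using I by (simp add: dc_simps)
  next
    fix u assume "u \<in> Ver A"
    then show "\<exists>\<gamma>\<in>Sqr A. sqleft A \<gamma> = vid A I \<and> sqright A \<gamma> = u" by (rule ver)
  next
    fix \<gamma> \<gamma>' \<alpha>
    assume s: "\<gamma> \<in> Sqr A" "\<gamma>' \<in> Sqr A" "\<alpha> \<in> Sqr A" "sqleft A \<gamma> = vid A I"
      "sqleft A \<gamma>' = vid A I" "sqleft A \<alpha> = sqright A \<gamma>" "sqright A \<alpha> = sqright A \<gamma>'"
    obtain \<psi> where \<psi>: "comparison (H_two_cat A) (sqtop A \<gamma>) (sqtop A \<gamma>') (sqtop A \<alpha>) \<psi>"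
      using mor[of "sqtop A \<gamma>" "sqtop A \<gamma>'" "sqtop A \<alpha>"] s I by (auto simp: dc_simps)
    obtain \<phi> where \<phi>: "comparison (H_two_cat A) (sqbot A \<gamma>) (sqbot A \<gamma>') (sqbot A \<alpha>) \<phi>"
      using mor[of "sqbot A \<gamma>" "sqbot A \<gamma>'" "sqbot A \<alpha>"] s I by (auto simp: dc_simps)
    have "\<psi> \<sslash> (\<gamma> \<parallel> \<alpha>) = \<gamma>' \<sslash> \<phi>" by (rule sqr[OF s \<psi> \<phi>])
    with \<psi> \<phi> s show "\<exists>s. comparison (V_two_cat A) \<gamma> \<gamma>' \<alpha> s"
      by (auto simp: comparison_V_iff)
  next
    fix \<gamma> \<gamma>' \<beta> \<Psi> \<Phi>
    assume g: "\<gamma> \<in> Sqr A" "\<gamma>' \<in> Sqr A" "sqleft A \<gamma> = vid A I" and \<beta>: "\<beta> \<in> V_cells A"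
      and l: "sqleft A (csrc (V_two_cat A) \<beta>) = sqright A \<gamma>"
      and c: "comparison (V_two_cat A) \<gamma> \<gamma>' (csrc (V_two_cat A) \<beta>) \<Psi>"
        "comparison (V_two_cat A) \<gamma> \<gamma>' (ctgt (V_two_cat A) \<beta>) \<Phi>"
    from \<beta> show "(\<beta> \<star>\<^bsub>V_two_cat A\<^esub> id2 (V_two_cat A) \<gamma>) \<circ>\<circ>\<^bsub>V_two_cat A\<^esub> \<Psi> = \<Phi>"
    proof (cases rule: V_cellE)
      case s: (1 \<alpha> \<alpha>' \<sigma>\<^sub>0 \<sigma>\<^sub>1 u v)
      have "\<Psi> \<in> V_cells A" "csrc (V_two_cat A) \<Psi> = \<gamma>'" "ctgt (V_two_cat A) \<Psi> = \<gamma> \<parallel> \<alpha>"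
        using c(1) s(1) by (simp_all add: comparison_def cell_invertible_def)
      then have g': "sqleft A \<gamma>' = sqleft A \<gamma>" "sqright A \<alpha> = sqright A \<gamma>'"
        using V.src_glob[of \<Psi>] V.tgt_glob[of \<Psi>] g l s by (simp_all add: hp.cat_simps)
      obtain \<psi>\<^sub>0 \<psi>\<^sub>1 where P: "\<Psi> = (\<gamma>', (\<psi>\<^sub>0, \<psi>\<^sub>1), \<gamma> \<parallel> \<alpha>)"
        "comparison (H_two_cat A) (sqtop A \<gamma>) (sqtop A \<gamma>') (sqtop A \<alpha>) \<psi>\<^sub>0"
        "comparison (H_two_cat A) (sqbot A \<gamma>) (sqbot A \<gamma>') (sqbot A \<alpha>) \<psi>\<^sub>1"
        using c(1) g g' l s by (auto simp: comparison_V_iff)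
      obtain \<phi>\<^sub>0 \<phi>\<^sub>1 where Q: "\<Phi> = (\<gamma>', (\<phi>\<^sub>0, \<phi>\<^sub>1), \<gamma> \<parallel> \<alpha>')"
        "comparison (H_two_cat A) (sqtop A \<gamma>) (sqtop A \<gamma>') (sqtop A \<alpha>') \<phi>\<^sub>0"
        "comparison (H_two_cat A) (sqbot A \<gamma>) (sqbot A \<gamma>') (sqbot A \<alpha>') \<phi>\<^sub>1"
        using c(2) g g' l s by (auto simp: comparison_V_iff)
      have "\<psi>\<^sub>0 \<sslash> (vidsq A (sqtop A \<gamma>) \<parallel> \<sigma>\<^sub>0) = \<phi>\<^sub>0"
        by (rule natural[where f' = "sqtop A \<gamma>'"]) (use g l s P Q I in \<open>simp_all add: dc_simps\<close>)
      moreover have "\<psi>\<^sub>1 \<sslash> (vidsq A (sqbot A \<gamma>) \<parallel> \<sigma>\<^sub>1) = \<phi>\<^sub>1"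
        by (rule natural[where f' = "sqbot A \<gamma>'"]) (use g l s P Q I in \<open>simp_all add: dc_simps\<close>)
      ultimately show ?thesis by (simp add: s(1) P(1) Q(1))
    qed
  qed
qed

text \<open>
  Bi-initiality in \<open>V\<close> only provides some comparisons that are natural with respect to a given square.
  Uniqueness of comparisons in \<open>\<^bold>H\<close> extends this to all comparisons.
\<close>

lemma double_bi_initial_if_bi_initial_V:
  assumes V: "bi_initial (V_two_cat A) (vid A I)" and I: "I \<in> Obj A"
  shows "double_bi_initial A I"
proof -
  have H: "bi_initial (H_two_cat A) I" by (rule bi_initial_H_if_bi_initial_V[OF V I])
  show ?thesis
    unfolding double_bi_initial_iff
  proof (intro conjI ballI allI impI; (elim conjE)?)
    show "I \<in> Obj A" by (fact I)
  next
    fix x assume "x \<in> Obj A"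
    with H show "\<exists>f\<in>Hor A. hdom A f = I \<and> hcod A f = x"
      using H.bi_initial_existsE[of I x] by auto
  next
    fix f f' a
    assume "f \<in> Hor A" "f' \<in> Hor A" "a \<in> Hor A" "hdom A f = I" "hdom A f' = I"
      "hdom A a = hcod A f" "hcod A a = hcod A f'"
    then show "\<exists>\<psi>. comparison (H_two_cat A) f f' a \<psi>"
      using H.bi_initial_comparisonE[OF H, of f f' a] by auto
  next
    fix u assume "u \<in> Ver A"
    then show "\<exists>\<gamma>\<in>Sqr A. sqleft A \<gamma> = vid A I \<and> sqright A \<gamma> = u"
      using V.bi_initial_existsE[OF V, of u] by auto
  next
    fix \<gamma> \<gamma>' \<alpha> \<psi> \<phi>
    assume s: "\<gamma> \<in> Sqr A" "\<gamma>' \<in> Sqr A" "\<alpha> \<in> Sqr A"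
        "sqleft A \<gamma> = vid A I" "sqleft A \<gamma>' = vid A I" "sqleft A \<alpha> = sqright A \<gamma>"
        "sqright A \<alpha> = sqright A \<gamma>'"
      and c: "comparison (H_two_cat A) (sqtop A \<gamma>) (sqtop A \<gamma>') (sqtop A \<alpha>) \<psi>"
        "comparison (H_two_cat A) (sqbot A \<gamma>) (sqbot A \<gamma>') (sqbot A \<alpha>) \<phi>"
    obtain s where "comparison (V_two_cat A) \<gamma> \<gamma>' \<alpha> s"
      by (rule V.bi_initial_comparisonE[OF V, of \<gamma> \<gamma>' \<alpha>]) (use s in simp_all)
    then obtain \<psi>\<^sub>0 \<psi>\<^sub>1 where
      c': "comparison (H_two_cat A) (sqtop A \<gamma>) (sqtop A \<gamma>') (sqtop A \<alpha>) \<psi>\<^sub>0"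
        "comparison (H_two_cat A) (sqbot A \<gamma>) (sqbot A \<gamma>') (sqbot A \<alpha>) \<psi>\<^sub>1"
      and e: "\<psi>\<^sub>0 \<sslash> (\<gamma> \<parallel> \<alpha>) = \<gamma>' \<sslash> \<psi>\<^sub>1"
      using s by (auto simp: comparison_V_iff)
    have "\<psi> = \<psi>\<^sub>0"
      by (rule H.bi_initial_comparison_unique[OF H _ _ _ _ c(1) c'(1)])
        (use s I in \<open>simp_all add: dc_simps\<close>)
    moreover have "\<phi> = \<psi>\<^sub>1"
      by (rule H.bi_initial_comparison_unique[OF H _ _ _ _ c(2) c'(2)])
        (use s I in \<open>simp_all add: dc_simps\<close>)
    ultimately show "\<psi> \<sslash> (\<gamma> \<parallel> \<alpha>) = \<gamma>' \<sslash> \<phi>" using e by simp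
  qed
qed

end

theorem theorem2:
  fixes A :: "('o, 'h, 'v, 's) double_cat" and I :: 'o
  assumes "double_category A" and "I \<in> Obj A"
  shows "(double_bi_initial A I \<longleftrightarrow>
            bi_initial (H_two_cat A) I \<and> bi_initial (V_two_cat A) (vid A I)) \<and>
         (bi_initial (H_two_cat A) I \<and> bi_initial (V_two_cat A) (vid A I) \<longleftrightarrow>
            bi_initial (V_two_cat A) (vid A I))"
proof -
  interpret double_category A by (fact assms(1))
  show ?thesis
    using bi_initial_H_if_bi_initial_V[of I] bi_initial_V_if_double_bi_initial[of I]
      double_bi_initial_if_bi_initial_V[of I] assms(2) by blast
qed

end
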